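(* Let $\mu\in\mathbb{R}^d$, let $\Sigma$ be a $d\times d$ symmetric positive definite matrix, let $q$ be the density of $N(\mu,\Sigma)$ on $\mathbb{R}^d$, and let $h(\theta)=\log p(y,\theta)-\log q(\theta)$, $\theta\in\mathbb{R}^d$. Let $CC^T$ and $TT^T$ be the Cholesky decompositions of $\Sigma$ and $\Sigma^{-1}$ respectively, where $C$ and $T$ are lower triangular matrices. (a) Define $G_1=\nabla_\theta h(\theta)(\theta-\mu)^T C^{-T}$ and $F_1=\nabla_\theta^2 h(\theta)\,C$. Then $\mathrm{E}_q(G_1)=\mathrm{E}_q(F_1)$ and $$\nabla_{\mathrm{vech}(C)}\mathrm{E}_q[h(\theta)]=\mathrm{E}_q\,\mathrm{vech}(G_1)=\mathrm{E}_q\,\mathrm{vech}(F_1).$$ (b) Define $G_2=-(\theta-\mu)\nabla_\theta h(\theta)^T T^{-T}$ and $F_2=-\Sigma\,\nabla_\theta^2 h(\theta)\,T^{-T}$. Then $\mathrm{E}_q(G_2)=\mathrm{E}_q(F_2)$ and $$\nabla_{\mathrm{vech}(T)}\mathrm{E}_q[h(\theta)]=\mathrm{E}_q\,\mathrm{vech}(G_2)=\mathrm{E}_q\,\mathrm{vech}(F_2).$$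
   Context: Notation. $\mathrm{E}_q$ is expectation over $\theta\sim q=N(\mu,\Sigma)$. $\nabla_\theta h$ is the column vector $\partial h/\partial\theta$ and $\nabla_\theta^2 h=\partial^2 h/\partial\theta\,\partial\theta^T$ is the $d\times d$ Hessian. $A^{-T}=(A^{-1})^T$. For a $d\times d$ matrix $A$, $\mathrm{vech}(A)\in\mathbb{R}^{d(d+1)/2}$ is obtained by stacking the columns of $A$ from left to right and deleting the entries strictly above the diagonal. The function $h$. $p(y,\theta)=p(y\mid\theta)p(\theta)$ is the joint density of fixed observed data $y$ and unknown $\theta\in\mathbb{R}^d$. For the purpose of the gradients, $h$ is treated as a function of $\theta$ that does not depend on the parameters being differentiated: the $q$ inside $h$ is frozen, and only the density with respect to which the expectation is taken is differentiated. Meaning of the gradients. $\nabla_{\mathrm{vech}(C)}\mathrm{E}_q[h(\theta)]$ is the vector of partial derivatives, with respect to the entries $C_{ij}$, $i\ge j$, evaluated at the given $C$, of the map $C'\mapsto\int h(\theta)\,N(\theta\mid\mu,C'C'^T)\,d\theta$ on lower triangular matrices, with $\mu$ and $h$ held fixed. Similarly $\nabla_{\mathrm{vech}(T)}\mathrm{E}_q[h(\theta)]$ is the vector of partial derivatives at $T$ of $T'\mapsto\int h(\theta)\,N(\theta\mid\mu,(T'T'^T)^{-1})\,d\theta$. Here $N(\theta\mid m,S)$ is the Gaussian density with mean $m$ and covariance $S$. Standing assumption. The functions to which Stein's Lemma, $\mathrm{E}_q[\Sigma^{-1}(\theta-\mu)f(\theta)]=\mathrm{E}_q[\nabla_\theta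 f(\theta)]$, is applied (here built from $h$ and from the components of $\nabla_\theta h$) have local absolute continuity, and the derivatives and expectations that appear are understood to exist. *)

theory Defs
  imports "HOL-Analysis.Analysis"
begin

section \<open>Matrices and half-vectorization\<close>

text \<open>These abbreviate \<open>real^'n\<close> and \<open>real^'n^'n\<close>, whose notation would force the sort
  \<open>finite\<close> on every occurrence of \<open>'n\<close>; here \<open>'n\<close> is to be linearly ordered as well.\<close>

type_synonym 'n rvec = "(real, 'n) vec"
type_synonym 'n sqmat = "((real, 'n) vec, 'n) vec"

definition sym_pos_def :: "real^'n^'n \<Rightarrow> bool" where
  "sym_pos_def S \<longleftrightarrow> transpose S = S \<and> (\<forall>x. x \<noteq> 0 \<longrightarrow> x \<bullet> (S *v x) > 0)"

definition lower_triangular :: "'n::{finite,linorder} sqmat \<Rightarrow> bool" where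
  "lower_triangular A \<longleftrightarrow> (\<forall>i j. i < j \<longrightarrow> A $ i $ j = 0)"

text \<open>No sign is imposed on the diagonal, so the usual factor with positive diagonal is
  a special case.\<close>

definition cholesky_decomp :: "'n::{finite,linorder} sqmat \<Rightarrow> 'n sqmat \<Rightarrow> bool" where
  "cholesky_decomp S L \<longleftrightarrow> lower_triangular L \<and> L ** transpose L = S"

text \<open>The positions \<open>(i, j)\<close>, \<open>i \<ge> j\<close>, of a lower triangular matrix, ordered column by column
  from left to right and by row within a column. A vector indexed by them is an element of
  $\mathbb{R}^{d(d+1)/2}$.\<close>

typedef (overloaded) ('n::linorder) ltri = "{p :: 'n \<times> 'n. snd p \<le> fst p}"
  by (rule exI[of _ "(undefined, undefined)"]) simp

definition row_of :: "'n::linorder ltri \<Rightarrow> 'n" where "row_of p = fst (Rep_ltri p)"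
definition col_of :: "'n::linorder ltri \<Rightarrow> 'n" where "col_of p = snd (Rep_ltri p)"

lemma ltri_eq_iff: "p = q \<longleftrightarrow> row_of p = row_of q \<and> col_of p = col_of q"
  by (metis Rep_ltri_inject col_of_def prod_eq_iff row_of_def)

lemma col_of_le_row_of: "col_of p \<le> row_of p"
  using Rep_ltri[of p] by (simp add: row_of_def col_of_def)

instantiation ltri :: (linorder) linorder
begin

definition less_eq_ltri :: "'a ltri \<Rightarrow> 'a ltri \<Rightarrow> bool" where
  "p \<le> q \<longleftrightarrow> col_of p < col_of q \<or> col_of p = col_of q \<and> row_of p \<le> row_of q"

definition less_ltri :: "'a ltri \<Rightarrow> 'a ltri \<Rightarrow> bool" where
  "p < q \<longleftrightarrow> col_of p < col_of q \<or> col_of p = col_of q \<and> row_of p < row_of q"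

instance
proof
  fix p q r :: "'a ltri"
  show "p < q \<longleftrightarrow> p \<le> q \<and> \<not> q \<le> p" and "p \<le> p" and "p \<le> q \<or> q \<le> p"
    by (auto simp: less_eq_ltri_def less_ltri_def)
  show "p \<le> r" if "p \<le> q" "q \<le> r"
    using that unfolding less_eq_ltri_def by (metis order.strict_trans order.trans)
  show "p = q" if "p \<le> q" "q \<le> p"
    using that unfolding less_eq_ltri_def ltri_eq_iff by (metis order.asym order.antisym)
qed

end

instance ltri :: ("{finite,linorder}") finite
proof
  have "inj (Rep_ltri :: 'a ltri \<Rightarrow> 'a \<times> 'a)"
    by (simp add: inj_def Rep_ltri_inject)
  then show "finite (UNIV :: 'a ltri set)"
    by (rule finite_imageD[rotated]) (rule finite)
qed

lemma CARD_ltri: "CARD('n::{finite,linorder} ltri) = CARD('n) * (CARD('n) + 1) div 2"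
proof -
  let ?L = "{p :: 'n \<times> 'n. snd p \<le> fst p}" and ?U = "{p :: 'n \<times> 'n. fst p \<le> snd p}"
  have "card ?L = CARD('n ltri)"
    by (rule type_definition.card[OF type_definition_ltri, symmetric])
  moreover have "card ?U = card ?L"
    by (rule bij_betw_same_card[of prod.swap], rule bij_betwI[where g = prod.swap]) auto
  moreover have "card (?L \<union> ?U) + card (?L \<inter> ?U) = card ?L + card ?U"
    by (rule card_Un_Int[symmetric]) simp_all
  moreover have "?L \<union> ?U = UNIV"
    by auto
  moreover have "?L \<inter> ?U = (\<lambda>i. (i, i)) ` UNIV"
    by auto
  moreover have "card ((\<lambda>i::'n. (i, i)) ` UNIV) = CARD('n)"
    by (rule card_image) (simp add: inj_on_def)
  moreover have "CARD('n \<times> 'n) = CARD('n) * CARD('n)"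
    by simp
  ultimately show ?thesis
    by simp
qed

definition vech :: "'n::{finite,linorder} sqmat \<Rightarrow> 'n ltri rvec" where
  "vech A = (\<chi> p. A $ row_of p $ col_of p)"

text \<open>\<open>v\<close> is the vector of partial derivatives of \<open>F\<close> at \<open>A\<close> with respect to the entries
  $A_{ij}$, $i \ge j$; \<open>axis i (axis j 1)\<close> is the matrix unit at position \<open>(i, j)\<close>.\<close>

definition has_vech_gradient ::
    "('n::{finite,linorder} sqmat \<Rightarrow> real) \<Rightarrow> 'n ltri rvec \<Rightarrow> 'n sqmat \<Rightarrow> bool" where
  "has_vech_gradient F v A \<longleftrightarrow>
     (\<forall>p. ((\<lambda>t. F (A + t *\<^sub>R axis (row_of p) (axis (col_of p) 1)))
             has_real_derivative v $ p) (at 0))"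

section \<open>The multivariate normal distribution\<close>

definition mvn_density :: "real^'n \<Rightarrow> real^'n^'n \<Rightarrow> real^'n \<Rightarrow> real" where
  "mvn_density m S x =
     exp (- ((x - m) \<bullet> (matrix_inv S *v (x - m))) / 2) / sqrt ((2 * pi) ^ CARD('n) * det S)"

definition mvn :: "real^'n \<Rightarrow> real^'n^'n \<Rightarrow> (real^'n) measure" where
  "mvn m S = density lborel (\<lambda>x. ennreal (mvn_density m S x))"

section \<open>Gradient, Hessian and local absolute continuity\<close>

definition partial_deriv :: "'n \<Rightarrow> (real^'n \<Rightarrow> real) \<Rightarrow> real^'n \<Rightarrow> real" where
  "partial_deriv i f x = deriv (\<lambda>t. f (x + t *\<^sub>R axis i 1)) 0"

definition grad :: "(real^'n \<Rightarrow> real) \<Rightarrow> real^'n \<Rightarrow> real^'n" where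
  "grad f x = (\<chi> i. partial_deriv i f x)"

definition hessian :: "(real^'n \<Rightarrow> real) \<Rightarrow> real^'n \<Rightarrow> real^'n^'n" where
  "hessian f x = (\<chi> i j. partial_deriv i (partial_deriv j f) x)"

definition ae_partials_exist :: "(real^'n \<Rightarrow> real) \<Rightarrow> bool" where
  "ae_partials_exist f \<longleftrightarrow>
     (AE x in lborel. \<forall>i. (\<lambda>t. f (x + t *\<^sub>R axis i 1)) differentiable (at 0))"

definition abs_continuous_on :: "real set \<Rightarrow> (real \<Rightarrow> real) \<Rightarrow> bool" where
  "abs_continuous_on S f \<longleftrightarrow>
     (\<forall>\<epsilon>>0. \<exists>\<delta>>0. \<forall>I :: (real \<times> real) set.
        finite I \<and> (\<forall>(u, v)\<in>I. u \<le> v \<and> {u..v} \<subseteq> S) \<and>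
        disjoint_family_on (\<lambda>(u, v). {u<..<v}) I \<and> (\<Sum>(u, v)\<in>I. v - u) < \<delta>
        \<longrightarrow> (\<Sum>(u, v)\<in>I. \<bar>f v - f u\<bar>) < \<epsilon>)"

text \<open>Local absolute continuity of a function of several variables: for each coordinate, on
  almost every line parallel to that coordinate axis, it is absolutely continuous on every
  compact interval. (Whether this holds on the line through \<open>x\<close> in direction \<open>i\<close> does not
  depend on the \<open>i\<close>-th coordinate of \<open>x\<close>, so almost every \<open>x\<close> means almost every line.)\<close>

definition locally_abs_continuous :: "(real^'n \<Rightarrow> real) \<Rightarrow> bool" where
  "locally_abs_continuous f \<longleftrightarrow>
     (\<forall>i. AE x in lborel. \<forall>a b. abs_continuous_on {a..b} (\<lambda>t. f (x + t *\<^sub>R axis i 1)))"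

end

theory Submission
  imports Defs
begin

text \<open>Write \<open>s = \<theta> - \<mu>\<close>, \<open>P = \<Sigma>\<^sup>-\<^sup>1\<close>, \<open>W = E[h s s\<^sup>T]\<close>, \<open>U = E[\<nabla>h s\<^sup>T]\<close> and \<open>V = E[\<nabla>\<^sup>2h]\<close>.
  Stein's identity for \<open>h s\<^sub>i\<close> gives \<open>U = P W - E[h] I\<close>, and for the components of \<open>\<nabla>h\<close> it gives
  \<open>V = P U\<^sup>T\<close>. Hence \<open>V = P W P - E[h] P\<close> is symmetric, although the Hessian of \<open>h\<close> need not be
  symmetric pointwise, and \<open>E[G\<^sub>1] = U C\<^sup>-\<^sup>T = V C = E[F\<^sub>1]\<close>, \<open>E[G\<^sub>2] = - U\<^sup>T T\<^sup>-\<^sup>T = - \<Sigma> V T\<^sup>-\<^sup>T = E[F\<^sub>2]\<close>.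
  Changing one entry of \<open>C\<close> or \<open>T\<close> is a rank one perturbation, so it multiplies the density by a
  factor and adds to the exponent a combination of two quadratic forms; differentiating under the
  integral expresses the gradients by \<open>W\<close> and \<open>E[h]\<close>, that is, by \<open>U\<close>. The domination needed, and the
  integrability of \<open>h\<close> times polynomials, come from the integrability of \<open>h\<close> against the wider
  Gaussian with factor \<open>(1 + \<epsilon>) C\<close>.\<close>

section \<open>Absolutely continuous functions on an interval\<close>

lemma abs_continuous_onE:
  assumes "abs_continuous_on S f" and "e > 0"
  obtains d where "d > 0"
    and "\<And>I. finite I \<Longrightarrow> \<forall>(u, v)\<in>I. u \<le> v \<and> {u..v} \<subseteq> S \<Longrightarrow>
        disjoint_family_on (\<lambda>(u, v). {u<..<v}) I \<Longrightarrow> (\<Sum>(u, v)\<in>I. v - u) < d \<Longrightarrow>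
        (\<Sum>(u, v)\<in>I. \<bar>f v - f u\<bar>) < e"
proof -
  obtain d where d: "d > 0" and D: "\<forall>I. finite I \<and> (\<forall>(u, v)\<in>I. u \<le> v \<and> {u..v} \<subseteq> S) \<and>
        disjoint_family_on (\<lambda>(u, v). {u<..<v}) I \<and> (\<Sum>(u, v)\<in>I. v - u) < d \<longrightarrow>
        (\<Sum>(u, v)\<in>I. \<bar>f v - f u\<bar>) < e"
    using assms(1)[unfolded abs_continuous_on_def, rule_format, OF assms(2)] by (elim exE conjE)
  from d show ?thesis
    by (rule that) (rule D[rule_format], intro conjI)
qed

text \<open>The definition is tested on a family consisting of the single interval between the two
  points.\<close>

lemma abs_continuous_on_imp_continuous_on:
  fixes f :: "real \<Rightarrow> real"
  assumes "abs_continuous_on {a..b} f"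
  shows "continuous_on {a..b} f"
  unfolding continuous_on_iff
proof (intro ballI allI impI)
  fix x e :: real
  assume x: "x \<in> {a..b}" and e: "e > 0"
  obtain d where d: "d > 0" and D: "\<And>I. finite I \<Longrightarrow> \<forall>(u, v)\<in>I. u \<le> v \<and> {u..v} \<subseteq> {a..b} \<Longrightarrow>
        disjoint_family_on (\<lambda>(u, v). {u<..<v}) I \<Longrightarrow> (\<Sum>(u, v)\<in>I. v - u) < d \<Longrightarrow>
        (\<Sum>(u, v)\<in>I. \<bar>f v - f u\<bar>) < e"
      using assms e by (rule abs_continuous_onE) blast
  have "dist (f y) (f x) < e" if y: "y \<in> {a..b}" "dist y x < d" for y
  proof -
    have "\<bar>f (max x y) - f (min x y)\<bar> < e"
      using D[of "{(min x y, max x y)}"] x y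
      by (auto simp: disjoint_family_on_def dist_real_def min_def max_def split: if_splits)
    then show ?thesis
      by (auto simp: dist_real_def min_def max_def split: if_splits)
  qed
  then show "\<exists>d>0. \<forall>x'\<in>{a..b}. dist x' x < d \<longrightarrow> dist (f x') (f x) < e"
    using d by blast
qed

text \<open>An increment of the product splits as
  \<open>f v * (g v - g u) + g u * (f v - f u)\<close>. The first part is at most a constant times
  the length of the interval, the second is governed by the absolute continuity of
  \<open>f\<close>.\<close>

lemma abs_continuous_on_mult_lipschitz:
  fixes f g :: "real \<Rightarrow> real"
  assumes f: "abs_continuous_on {a..b} f" and g: "L-lipschitz_on {a..b} g"
  shows "abs_continuous_on {a..b} (\<lambda>t. f t * g t)"
proof -
  have "bounded (f ` {a..b})" "bounded (g ` {a..b})"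
    using abs_continuous_on_imp_continuous_on[OF f] lipschitz_on_continuous_on[OF g]
    by (auto intro: compact_imp_bounded compact_continuous_image)
  then obtain B B' where B: "B > 0" "\<And>t. t \<in> {a..b} \<Longrightarrow> \<bar>f t\<bar> \<le> B"
    and B': "B' > 0" "\<And>t. t \<in> {a..b} \<Longrightarrow> \<bar>g t\<bar> \<le> B'"
    unfolding bounded_pos by auto
  have L: "L \<ge> 0"
    using g by (rule lipschitz_on_nonneg)
  show ?thesis
    unfolding abs_continuous_on_def
  proof (intro allI impI)
    fix e :: real
    assume e: "e > 0"
    then have "e / (2 * B') > 0"
      using B' by simp
    with f obtain d where d: "d > 0" and D: "\<And>I. finite I \<Longrightarrow> \<forall>(u, v)\<in>I. u \<le> v \<and> {u..v} \<subseteq> {a..b} \<Longrightarrow>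
        disjoint_family_on (\<lambda>(u, v). {u<..<v}) I \<Longrightarrow> (\<Sum>(u, v)\<in>I. v - u) < d \<Longrightarrow>
        (\<Sum>(u, v)\<in>I. \<bar>f v - f u\<bar>) < e / (2 * B')"
      by (rule abs_continuous_onE) blast
    \<comment> \<open>Half of \<open>e\<close> is allotted to each part of the splitting;
      \<open>L + 1\<close> keeps the divisor positive when \<open>L = 0\<close>.\<close>
    define d' where "d' = min d (e / (2 * B * (L + 1)))"
    have "d' > 0"
      using d e B L by (simp add: d'_def)
    moreover have "(\<Sum>(u, v)\<in>I. \<bar>f v * g v - f u * g u\<bar>) < e"
      if I: "finite I" "\<forall>(u, v)\<in>I. u \<le> v \<and> {u..v} \<subseteq> {a..b}"
        "disjoint_family_on (\<lambda>(u, v). {u<..<v}) I" "(\<Sum>(u, v)\<in>I. v - u) < d'" for I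
    proof -
      have "\<bar>f v * g v - f u * g u\<bar> \<le> B * (L + 1) * (v - u) + B' * \<bar>f v - f u\<bar>" if "(u, v) \<in> I" for u v
      proof -
        have uv: "u \<le> v" "u \<in> {a..b}" "v \<in> {a..b}"
          using I(2) that by force+
        have "\<bar>g v - g u\<bar> \<le> L * (v - u)"
          using lipschitz_onD[OF g uv(3,2)] uv(1) by (simp add: dist_real_def)
        also have "\<dots> \<le> (L + 1) * (v - u)"
          using uv(1) by (intro mult_right_mono) auto
        finally have *: "\<bar>g v - g u\<bar> \<le> (L + 1) * (v - u)" .
        have "f v * g v - f u * g u = f v * (g v - g u) + g u * (f v - f u)"
          by (simp add: algebra_simps)
        then have "\<bar>f v * g v - f u * g u\<bar> \<le> \<bar>f v\<bar> * \<bar>g v - g u\<bar> + \<bar>g u\<bar> * \<bar>f v - f u\<bar>"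
          by (metis abs_mult abs_triangle_ineq)
        also have "\<dots> \<le> B * ((L + 1) * (v - u)) + B' * \<bar>f v - f u\<bar>"
          using B(2)[OF uv(3)] B'(2)[OF uv(2)] * B(1) by (intro add_mono mult_mono) auto
        finally show ?thesis
          by (simp add: mult.assoc)
      qed
      then have "(\<Sum>(u, v)\<in>I. \<bar>f v * g v - f u * g u\<bar>)
          \<le> (\<Sum>(u, v)\<in>I. B * (L + 1) * (v - u) + B' * \<bar>f v - f u\<bar>)"
        by (intro sum_mono) auto
      also have "\<dots> = B * (L + 1) * (\<Sum>(u, v)\<in>I. v - u) + B' * (\<Sum>(u, v)\<in>I. \<bar>f v - f u\<bar>)"
        by (simp add: sum.distrib sum_distrib_left split_def)
      also have "\<dots> < e / 2 + e / 2"
      proof (rule add_strict_mono)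
        have "B * (L + 1) * (\<Sum>(u, v)\<in>I. v - u) < B * (L + 1) * (e / (2 * B * (L + 1)))"
          using I(4) B(1) L by (intro mult_strict_left_mono) (auto simp: d'_def)
        also have "B * (L + 1) * (e / (2 * B * (L + 1))) = e / 2"
          using B(1) L by (simp add: divide_simps)
        finally show "B * (L + 1) * (\<Sum>(u, v)\<in>I. v - u) < e / 2" .
        have "(\<Sum>(u, v)\<in>I. \<bar>f v - f u\<bar>) < e / (2 * B')"
          using D[of I] I by (simp add: d'_def)
        then show "B' * (\<Sum>(u, v)\<in>I. \<bar>f v - f u\<bar>) < e / 2"
          using B'(1) by (simp add: field_simps)
      qed
      finally show ?thesis
        by simp
    qed
    ultimately show "\<exists>d>0. \<forall>I. finite I \<and> (\<forall>(u, v)\<in>I. u \<le> v \<and> {u..v} \<subseteq> {a..b}) \<and>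
        disjoint_family_on (\<lambda>(u, v). {u<..<v}) I \<and> (\<Sum>(u, v)\<in>I. v - u) < d
        \<longrightarrow> (\<Sum>(u, v)\<in>I. \<bar>f v * g v - f u * g u\<bar>) < e"
      by blast
  qed
qed

lemma C1_lipschitz_on:
  fixes g :: "real \<Rightarrow> real"
  assumes g: "\<And>t. t \<in> {a..b} \<Longrightarrow> (g has_real_derivative g' t) (at t)" and g': "continuous_on {a..b} g'"
  obtains L where "L-lipschitz_on {a..b} g"
proof -
  have "bounded (g' ` {a..b})"
    using g' by (intro compact_imp_bounded compact_continuous_image) auto
  then obtain B where "B > 0" "\<And>t. t \<in> {a..b} \<Longrightarrow> \<bar>g' t\<bar> \<le> B"
    unfolding bounded_pos by auto
  then have "B-lipschitz_on {a..b} g"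
    using g by (intro bounded_derivative_imp_lipschitz[where f' = "\<lambda>t. (*) (g' t)"])
      (auto simp: has_field_derivative_def intro: has_derivative_at_withinI intro!: onorm_le simp: abs_mult mult_right_mono)
  then show ?thesis
    by (rule that)
qed

text \<open>A gauge integral argument. Cells tagged off \<open>N\<close> obey the usual straddle
  estimate. Cells tagged in \<open>N\<close> lie in an open set of small measure, so absolute
  continuity makes the increments of \<open>f\<close> over them small in total.\<close>

lemma abs_continuous_fundamental_theorem:
  fixes f f' :: "real \<Rightarrow> real"
  assumes "a \<le> b" and ac: "abs_continuous_on {a..b} f" and N: "negligible N"
    and der: "\<And>x. x \<in> {a..b} - N \<Longrightarrow> (f has_vector_derivative f' x) (at x within {a..b})"
  shows "(f' has_integral f b - f a) {a..b}"
proof (cases "a = b")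
  case True
  then show ?thesis by (simp add: has_integral_refl)
next
  case False
  then have ab: "a < b" using assms by simp
  \<comment> \<open>With the integrand reset to 0 on \<open>N\<close>, the terms of a Riemann sum
    tagged there are compared with increments of \<open>f\<close> alone; changing values on
    \<open>N\<close> back does not affect the integral.\<close>
  define g where "g x = (if x \<in> N then 0 else f' x)" for x
  have "(g has_integral f b - f a) {a..b}"
    unfolding has_integral_factor_content box_real[symmetric]
  proof safe
    fix e :: real
    assume e: "e > 0"
    have "\<forall>x. \<exists>d>0. x \<in> {a..b} - N \<longrightarrow>
         (\<forall>y\<in>{a..b}. norm (y-x) < d \<longrightarrow> norm (f y - f x - (y-x) *\<^sub>R f' x) \<le> e / 2 * norm (y-x))"
      using der[unfolded has_vector_derivative_def has_derivative_within_alt] e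
      by (metis half_gt_zero)
    then obtain d where d: "\<And>x. 0 < d x"
        "\<And>x y. \<lbrakk>x \<in> {a..b} - N; y \<in> {a..b}; norm (y-x) < d x\<rbrakk>
             \<Longrightarrow> norm (f y - f x - (y-x) *\<^sub>R f' x) \<le> e / 2 * norm (y-x)"
      by metis
    have "e / 2 * (b - a) > 0"
      using e ab by simp
    with ac obtain \<delta> where \<delta>: "\<delta> > 0" and D: "\<And>I. finite I \<Longrightarrow> \<forall>(u, v)\<in>I. u \<le> v \<and> {u..v} \<subseteq> {a..b} \<Longrightarrow>
        disjoint_family_on (\<lambda>(u, v). {u<..<v}) I \<Longrightarrow> (\<Sum>(u, v)\<in>I. v - u) < \<delta> \<Longrightarrow>
        (\<Sum>(u, v)\<in>I. \<bar>f v - f u\<bar>) < e / 2 * (b - a)"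
      by (rule abs_continuous_onE) blast
    \<comment> \<open>Outer regularity: an open cover of the null set \<open>N\<close> whose measure
      is below the \<open>\<delta>\<close> of absolute continuity.\<close>
    obtain U where U: "open U" "N \<subseteq> U" "U \<in> lmeasurable" "measure lebesgue U < \<delta>"
    proof -
      have "N \<in> sets lebesgue"
        using N negligible_imp_sets by blast
      then obtain U where U: "open U" "N \<subseteq> U" "U - N \<in> lmeasurable" "emeasure lebesgue (U - N) < ennreal \<delta>"
        using sets_lebesgue_outer_open[OF _ \<delta>] by blast
      have "N \<in> null_sets lebesgue"
        using N by (simp add: negligible_iff_null_sets)
      then have eq: "emeasure lebesgue U = emeasure lebesgue (U - N)"
        using U by (simp add: emeasure_Diff_null_set)
      with U have U': "U \<in> lmeasurable"
        by (intro fmeasurableI) (auto intro: less_trans)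
      then have "ennreal (measure lebesgue U) < ennreal \<delta>"
        using U(4) eq by (simp add: emeasure_eq_measure2)
      then have "measure lebesgue U < \<delta>"
        by (simp add: ennreal_less_iff)
      with U(1,2) U' show ?thesis
        by (rule that)
    qed
    \<comment> \<open>Off \<open>N\<close> the gauge is the radius of differentiability; a tag in
      \<open>N\<close> only forces its cell into \<open>U\<close>.\<close>
    define \<gamma> where "\<gamma> x = (if x \<in> N then U else ball x (d x))" for x
    show "\<exists>d. gauge d \<and> (\<forall>p. p tagged_division_of (cbox a b) \<and> d fine p \<longrightarrow>
      norm ((\<Sum>(x, k)\<in>p. measure lborel k *\<^sub>R g x) - (f b - f a)) \<le> e * measure lborel (cbox a b))"
    proof (rule exI[of _ \<gamma>], safe)
      show "gauge \<gamma>"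
        using d(1) U unfolding gauge_def \<gamma>_def by auto
    next
      fix p
      assume ptag: "p tagged_division_of cbox a b" and fine: "\<gamma> fine p"
      have "finite p"
        using ptag by blast
      have ba: "b - a = (\<Sum>(x,K)\<in>p. Sup K - Inf K)" "f b - f a = (\<Sum>(x,K)\<in>p. f(Sup K) - f(Inf K))"
        using additive_tagged_division_1[where f= "\<lambda>x. x"] additive_tagged_division_1[where f= f]
            \<open>a \<le> b\<close> ptag by auto
      have cell: "\<exists>u v. K = {u..v} \<and> u \<le> v \<and> x \<in> K \<and> K \<subseteq> {a..b}" if "(x, K) \<in> p" for x K
        using tagged_division_ofD(2,3,4)[OF ptag that]
        by (metis atLeastatMost_empty_iff box_real(2) empty_iff)
      define p1 where "p1 = {(x, K) \<in> p. x \<in> N}"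
      define p2 where "p2 = {(x, K) \<in> p. x \<notin> N}"
      have p12: "p = p1 \<union> p2" "p1 \<inter> p2 = {}" "finite p1" "finite p2"
        using \<open>finite p\<close> by (auto simp: p1_def p2_def intro: rev_finite_subset)
      have 2: "norm (measure lborel K *\<^sub>R g x - (f (Sup K) - f (Inf K))) \<le> e / 2 * (Sup K - Inf K)"
        if xK: "(x, K) \<in> p2" for x K
      proof -
        have "(x, K) \<in> p" and x: "x \<notin> N"
          using xK by (auto simp: p2_def)
        then obtain u v where K: "K = {u..v}" "u \<le> v" "x \<in> K" "K \<subseteq> {a..b}"
          using cell by blast
        have ball: "K \<subseteq> ball x (d x)"
          using fineD[OF fine \<open>(x, K) \<in> p\<close>] x by (simp add: \<gamma>_def)
        have uv: "u \<in> K" "v \<in> K"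
          using K by auto
        then have uv': "norm (u - x) < d x" "norm (v - x) < d x"
          using ball by (auto simp: subset_iff dist_norm norm_minus_commute)
        \<comment> \<open>The tag lies between the end points, so the distances from
          \<open>u\<close> to \<open>x\<close> and from \<open>x\<close> to \<open>v\<close> add up
          to the length of the cell.\<close>
        have "norm ((v - u) *\<^sub>R f' x - (f v - f u)) = norm (f u - f x - (u - x) *\<^sub>R f' x - (f v - f x - (v - x) *\<^sub>R f' x))"
          by (auto simp: algebra_simps)
        also have "\<dots> \<le> norm (f u - f x - (u - x) *\<^sub>R f' x) + norm (f v - f x - (v - x) *\<^sub>R f' x)"
          by (rule norm_triangle_ineq4)
        also have "\<dots> \<le> e / 2 * norm (u - x) + e / 2 * norm (v - x)"
          using uv uv' K x by (intro add_mono d) auto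
        also have "\<dots> = e / 2 * (Sup K - Inf K)"
          using K by (auto simp: field_simps)
        finally show ?thesis
          using K x by (simp add: g_def)
      qed
      have "norm (\<Sum>(x, K)\<in>p2. measure lborel K *\<^sub>R g x - (f (Sup K) - f (Inf K)))
          \<le> (\<Sum>(x, K)\<in>p2. e / 2 * (Sup K - Inf K))"
        unfolding split_def by (rule sum_norm_le) (use 2 in auto)
      also have "\<dots> \<le> (\<Sum>(x, K)\<in>p. e / 2 * (Sup K - Inf K))"
        using \<open>finite p\<close> e cell by (intro sum_mono2) (force simp: p12)+
      also have "\<dots> = e / 2 * (b - a)"
        by (simp add: ba sum_distrib_left split_def)
      finally have P2: "norm (\<Sum>(x, K)\<in>p2. measure lborel K *\<^sub>R g x - (f (Sup K) - f (Inf K))) \<le> e / 2 * (b - a)" .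

      have p1: "p1 tagged_division_of \<Union>(snd ` p1)"
        using ptag p12(1) by (metis sup_ge1 tagged_division_of_def tagged_partial_division_of_Union_self tagged_partial_division_subset)
      then have div: "snd ` p1 division_of \<Union>(snd ` p1)"
        by (rule division_of_tagged_division)
      define I where "I = (\<lambda>K. (Inf K, Sup K)) ` snd ` p1"
      have cell1: "\<exists>u v. K = {u..v} \<and> u \<le> v \<and> K \<subseteq> {a..b} \<and> K \<subseteq> U" if K: "K \<in> snd ` p1" for K
      proof -
        obtain x where x: "(x, K) \<in> p" "x \<in> N"
          using K unfolding p1_def by force
        then have "K \<subseteq> U"
          using fineD[OF fine x(1)] x(2) by (simp add: \<gamma>_def)
        then show ?thesis
          using cell[OF x(1)] by blast
      qed
      have inj: "inj_on (\<lambda>K. (Inf K, Sup K)) (snd ` p1)"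
      proof (rule inj_onI)
        fix K K' :: "real set"
        assume "K \<in> snd ` p1" "K' \<in> snd ` p1" and eq: "(Inf K, Sup K) = (Inf K', Sup K')"
        with cell1[of K] cell1[of K'] show "K = K'"
          by auto
      qed
      \<comment> \<open>Two tags can share a cell only if that cell is degenerate, since distinct
        tagged cells have disjoint interiors. Summing over cells instead of tagged cells is
        therefore harmless for a \<open>\<phi>\<close> vanishing on the diagonal.\<close>
      have sumI: "(\<Sum>(u, v)\<in>I. \<phi> u v) = (\<Sum>(x, K)\<in>p1. \<phi> (Inf K) (Sup K))"
        if "\<And>u. \<phi> u u = 0" for \<phi> :: "real \<Rightarrow> real \<Rightarrow> real"
      proof -
        define \<psi> where "\<psi> K = (if K = {} then 0 else \<phi> (Inf K) (Sup K))" for K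
        have ne: "K \<noteq> {}" if "K \<in> snd ` p1" for K
          using cell1[OF that] by auto
        have "(\<Sum>(u, v)\<in>I. \<phi> u v) = (\<Sum>K\<in>snd ` p1. \<psi> K)"
          unfolding I_def using ne by (subst sum.reindex[OF inj]) (auto simp: \<psi>_def intro!: sum.cong)
        also have "\<dots> = (\<Sum>(x, K)\<in>p1. \<psi> K)"
        proof (rule sum.over_tagged_division_lemma[OF p1, symmetric])
          show "\<psi> (cbox u v) = 0" if "box u v = {}" for u v
            using that \<open>\<And>u. \<phi> u u = 0\<close> by (cases "u = v") (auto simp: \<psi>_def)
        qed
        also have "\<dots> = (\<Sum>(x, K)\<in>p1. \<phi> (Inf K) (Sup K))"
          using ne by (intro sum.cong) (force simp: \<psi>_def)+
        finally show ?thesis .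
      qed
      \<comment> \<open>The cells do not overlap, so their total length is the measure of their
        union, which is contained in \<open>U\<close>.\<close>
      have "(\<Sum>(u, v)\<in>I. v - u) = (\<Sum>K\<in>snd ` p1. measure lebesgue K)"
        unfolding I_def using cell1 by (subst sum.reindex[OF inj]) (force intro!: sum.cong)
      also have "\<dots> = measure lebesgue (\<Union>(snd ` p1))"
        by (rule content_division[OF div])
      also have "\<dots> \<le> measure lebesgue U"
        using cell1 div U(3) by (intro measure_mono_fmeasurable) (auto dest: lmeasurable_division)
      finally have "(\<Sum>(u, v)\<in>I. v - u) < \<delta>"
        using U by simp
      moreover have "disjoint_family_on (\<lambda>(u, v). {u<..<v}) I"
      proof -
        have "{Inf K<..<Sup K} \<inter> {Inf K'<..<Sup K'} = {}" if "K \<in> snd ` p1" "K' \<in> snd ` p1" "K \<noteq> K'" for K K'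
          using division_ofD(5)[OF div that] cell1[OF that(1)] cell1[OF that(2)] by auto
        then show ?thesis
          unfolding disjoint_family_on_def I_def by (metis (no_types, lifting) case_prod_conv imageE)
      qed
      moreover have "finite I"
        using p12 by (simp add: I_def)
      moreover have "\<forall>(u, v)\<in>I. u \<le> v \<and> {u..v} \<subseteq> {a..b}"
        using cell1 by (force simp: I_def)
      ultimately have "(\<Sum>(u, v)\<in>I. \<bar>f v - f u\<bar>) < e / 2 * (b - a)"
        by (intro D)
      then have "(\<Sum>(x, K)\<in>p1. \<bar>f (Sup K) - f (Inf K)\<bar>) < e / 2 * (b - a)"
        by (subst (asm) sumI) auto
      moreover have "norm (\<Sum>(x, K)\<in>p1. measure lborel K *\<^sub>R g x - (f (Sup K) - f (Inf K)))
          \<le> (\<Sum>(x, K)\<in>p1. \<bar>f (Sup K) - f (Inf K)\<bar>)"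
        unfolding split_def by (rule sum_norm_le) (auto simp: p1_def g_def)
      ultimately have P1: "norm (\<Sum>(x, K)\<in>p1. measure lborel K *\<^sub>R g x - (f (Sup K) - f (Inf K))) \<le> e / 2 * (b - a)"
        by linarith
      have "(\<Sum>(x, K)\<in>p. measure lborel K *\<^sub>R g x) - (f b - f a)
          = (\<Sum>(x, K)\<in>p. measure lborel K *\<^sub>R g x - (f (Sup K) - f (Inf K)))"
        by (simp add: ba split_def sum_subtractf)
      also have "\<dots> = (\<Sum>(x, K)\<in>p1. measure lborel K *\<^sub>R g x - (f (Sup K) - f (Inf K)))
          + (\<Sum>(x, K)\<in>p2. measure lborel K *\<^sub>R g x - (f (Sup K) - f (Inf K)))"
        using p12 by (simp add: sum.union_disjoint)
      finally have eq: "(\<Sum>(x, K)\<in>p. measure lborel K *\<^sub>R g x) - (f b - f a) =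
          (\<Sum>(x, K)\<in>p1. measure lborel K *\<^sub>R g x - (f (Sup K) - f (Inf K)))
          + (\<Sum>(x, K)\<in>p2. measure lborel K *\<^sub>R g x - (f (Sup K) - f (Inf K)))" .
      have "norm ((\<Sum>(x, K)\<in>p. measure lborel K *\<^sub>R g x) - (f b - f a)) \<le> e / 2 * (b - a) + e / 2 * (b - a)"
        unfolding eq by (rule norm_triangle_le[OF add_mono[OF P1 P2]])
      then show "norm ((\<Sum>(x, K)\<in>p. measure lborel K *\<^sub>R g x) - (f b - f a)) \<le> e * measure lborel (cbox a b)"
        using ab by simp
    qed
  qed
  then show ?thesis
    by (rule has_integral_spike[OF N, rotated]) (simp add: g_def)
qed

section \<open>Derivatives along almost every line\<close>

lemma integrable_lborel_translate:
  fixes f :: "'a::euclidean_space \<Rightarrow> 'b::{banach, second_countable_topology}"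
  assumes "integrable lborel f"
  shows "integrable lborel (\<lambda>x. f (x + c))"
proof -
  have "integrable (distr lborel borel ((+) c)) f"
    by (subst lborel_distr_plus) (rule assms)
  then show ?thesis
    by (subst (asm) integrable_distr_eq) (use assms in \<open>auto simp: add.commute\<close>)
qed

lemma integral_lborel_translate:
  fixes f :: "'a::euclidean_space \<Rightarrow> 'b::{banach, second_countable_topology}"
  assumes [measurable]: "f \<in> borel_measurable borel"
  shows "(\<integral>x. f (x + c) \<partial>lborel) = (\<integral>x. f x \<partial>lborel)"
proof -
  have "(\<integral>x. f x \<partial>lborel) = (\<integral>x. f x \<partial>distr lborel borel ((+) c))"
    by (subst lborel_distr_plus) simp
  then show ?thesis
    by (subst (asm) integral_distr) (auto simp: add.commute)
qed

text \<open>For each fixed \<open>t\<close> the translated exceptional set is null; Fubini exchanges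
  the two quantifiers.\<close>

lemma AE_lborel_line:
  fixes e :: "'a::euclidean_space"
  assumes "AE x in lborel. P x"
  shows "AE x in lborel. AE t in lborel. P (x + t *\<^sub>R e)"
proof -
  \<comment> \<open>The exceptional set itself may fail to be Borel, so it is enclosed in a Borel
    null set before Fubini is applied.\<close>
  obtain N where N: "N \<in> null_sets lborel" "{x. \<not> P x} \<subseteq> N"
    using assms unfolding eventually_ae_filter by auto
  have [measurable]: "N \<in> sets borel"
    using N by auto
  have N0: "AE x in lborel. x + c \<notin> N" for c
  proof -
    have "AE x in distr lborel borel ((+) c). x \<notin> N"
      by (subst lborel_distr_plus) (rule AE_not_in[OF N(1)])
    then show ?thesis
      by (subst (asm) AE_distr_iff) (auto simp: add.commute)
  qed
  have "AE x in lborel. AE t in lborel. x + (t::real) *\<^sub>R e \<notin> N"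
  proof (subst lborel_pair.AE_commute)
    have "{p \<in> space (lborel \<Otimes>\<^sub>M lborel). fst p + snd p *\<^sub>R e \<notin> N} \<in> sets (lborel \<Otimes>\<^sub>M (lborel :: real measure))"
      by measurable
    then show "{p \<in> space (lborel \<Otimes>\<^sub>M (lborel :: real measure)). fst p + snd p *\<^sub>R e \<notin> N} \<in> sets (lborel \<Otimes>\<^sub>M lborel)" .
    show "AE t in lborel. AE x in lborel. x + (t::real) *\<^sub>R e \<notin> N"
      using N0 by simp
  qed
  then show ?thesis
    using N(2) by (auto elim!: eventually_mono)
qed

text \<open>By translation invariance the integral of the norm over \<open>x\<close> is the same for
  every \<open>t\<close> in the segment, so the Fubini criterion holds with \<open>x\<close> as the
  inner variable.\<close>

lemma integrable_lborel_segment: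
  fixes f :: "'a::euclidean_space \<Rightarrow> real"
  assumes f: "integrable lborel f"
  shows "integrable (lborel \<Otimes>\<^sub>M lborel) (\<lambda>(x, t). indicator {0..s} t * f (x + t *\<^sub>R e))"
proof -
  have [measurable]: "f \<in> borel_measurable borel"
    using f by auto
  have "integrable (lborel \<Otimes>\<^sub>M lborel) (\<lambda>(t, x). indicator {0..s} t * f (x + t *\<^sub>R e))"
  proof (rule lborel_pair.Fubini_integrable)
    have "(\<integral>x. norm (f (x + c)) \<partial>lborel) = (\<integral>x. norm (f x) \<partial>lborel)" for c
      by (rule integral_lborel_translate[of "\<lambda>x. norm (f x)"]) simp
    moreover have "integrable lborel (\<lambda>t. indicator {0..s} t * (\<integral>x. norm (f x) \<partial>lborel))"
      by (intro integrable_mult_left integrable_real_indicator) (auto simp: emeasure_lborel_Icc_eq)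
    ultimately show "integrable lborel (\<lambda>t. \<integral>x. norm (case (t, x) of (t, x) \<Rightarrow> indicator {0..s} t * f (x + t *\<^sub>R e)) \<partial>lborel)"
      by (simp add: abs_mult)
    show "AE t in lborel. integrable lborel (\<lambda>x. case (t, x) of (t, x) \<Rightarrow> indicator {0..s} t * f (x + t *\<^sub>R e))"
      using integrable_lborel_translate[OF f] by simp
  qed measurable
  then show ?thesis
    using lborel_pair.integrable_product_swap[of "\<lambda>(t, x). indicator {0..s} t * f (x + t *\<^sub>R e)"] by simp
qed

text \<open>On almost every line the parameters without the right derivative form a null set, so the
  fundamental theorem applies on \<open>{0..s}\<close>. Integrability along almost every segment
  identifies the gauge integral with the Lebesgue integral.\<close>

lemma line_increment_eq_integral:
  fixes g g' :: "'a::euclidean_space \<Rightarrow> real"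
  assumes g': "integrable lborel g'" and "s \<ge> 0"
    and ac: "AE x in lborel. \<forall>a b. abs_continuous_on {a..b} (\<lambda>t. g (x + t *\<^sub>R e))"
    and der: "AE x in lborel. ((\<lambda>t. g (x + t *\<^sub>R e)) has_real_derivative g' x) (at 0)"
  shows "AE x in lborel. g (x + s *\<^sub>R e) - g x = (\<integral>t. indicator {0..s} t * g' (x + t *\<^sub>R e) \<partial>lborel)"
proof -
  have int: "AE x in lborel. integrable lborel (\<lambda>t. indicator {0..s} t * g' (x + t *\<^sub>R e))"
    using lborel_pair.AE_integrable_fst[OF integrable_lborel_segment[OF g']] .
  show ?thesis
    using int ac AE_lborel_line[OF der, of e]
  proof eventually_elim
    case (elim x)
    obtain N where N: "N \<in> null_sets lborel"
      "{t. \<not> ((\<lambda>\<tau>. g (x + t *\<^sub>R e + \<tau> *\<^sub>R e)) has_real_derivative g' (x + t *\<^sub>R e)) (at 0)} \<subseteq> N"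
      using elim(3) unfolding eventually_ae_filter by auto
    have "negligible N"
      using N(1) negligible_iff_null_sets null_sets_completionI by blast
    moreover have "((\<lambda>t. g (x + t *\<^sub>R e)) has_vector_derivative g' (x + t *\<^sub>R e)) (at t within {0..s})"
      if "t \<in> {0..s} - N" for t
    proof -
      have "((\<lambda>\<tau>. g (x + (t + \<tau>) *\<^sub>R e)) has_real_derivative g' (x + t *\<^sub>R e)) (at 0)"
        using that N(2) by (auto simp: algebra_simps)
      then have "((\<lambda>\<tau>. g (x + \<tau> *\<^sub>R e)) has_real_derivative g' (x + t *\<^sub>R e)) (at t)"
        using DERIV_shift[of "\<lambda>\<tau>. g (x + \<tau> *\<^sub>R e)" _ 0 t] by (simp add: add.commute)
      then show ?thesis
        by (auto simp: has_real_derivative_iff_has_vector_derivative intro: has_vector_derivative_at_within)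
    qed
    ultimately have "((\<lambda>t. g' (x + t *\<^sub>R e)) has_integral g (x + s *\<^sub>R e) - g (x + 0 *\<^sub>R e)) {0..s}"
      using \<open>s \<ge> 0\<close> elim(2) by (intro abs_continuous_fundamental_theorem) auto
    then have "((\<lambda>t. indicator {0..s} t * g' (x + t *\<^sub>R e)) has_integral g (x + s *\<^sub>R e) - g x) UNIV"
      by (subst (asm) has_integral_restrict_UNIV[symmetric])
        (auto simp: indicator_def if_distrib[of "\<lambda>z. z * _"] if_distrib[of of_bool] elim!: has_integral_eq_rhs has_integral_cong[THEN iffD1, rotated])
    moreover have "((\<lambda>t. indicator {0..s} t * g' (x + t *\<^sub>R e)) has_integral
        (\<integral>t. indicator {0..s} t * g' (x + t *\<^sub>R e) \<partial>lborel)) UNIV"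
      by (rule has_integral_integral_lborel[OF elim(1)])
    ultimately show ?case
      by (rule has_integral_unique)
  qed
qed

text \<open>Integrating the increment over a translation of length \<open>s\<close> and exchanging the integrals
  gives \<open>s\<close> times the integral of the derivative, and no limit along the lines is needed.\<close>

lemma integral_directional_derivative_eq_0:
  fixes g g' :: "'a::euclidean_space \<Rightarrow> real"
  assumes g: "integrable lborel g" and g': "integrable lborel g'"
    and ac: "AE x in lborel. \<forall>a b. abs_continuous_on {a..b} (\<lambda>t. g (x + t *\<^sub>R e))"
    and der: "AE x in lborel. ((\<lambda>t. g (x + t *\<^sub>R e)) has_real_derivative g' x) (at 0)"
  shows "(\<integral>x. g' x \<partial>lborel) = 0"
proof -
  have [measurable]: "g \<in> borel_measurable borel" "g' \<in> borel_measurable borel"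
    using g g' by auto
  \<comment> \<open>The two terms of the increment have equal integrals by translation
    invariance.\<close>
  have "0 = (\<integral>x. g (x + 1 *\<^sub>R e) - g x \<partial>lborel)"
    using integrable_lborel_translate[OF g, of e] g integral_lborel_translate[of g e] by simp
  also have "\<dots> = (\<integral>x. \<integral>t. indicator {0..1} t * g' (x + t *\<^sub>R e) \<partial>lborel \<partial>lborel)"
    by (rule integral_cong_AE) (use line_increment_eq_integral[OF g' _ ac der, of 1] in \<open>auto intro!: lborel.borel_measurable_lebesgue_integral\<close>)
  also have "\<dots> = (\<integral>t. \<integral>x. indicator {0..1} t * g' (x + t *\<^sub>R e) \<partial>lborel \<partial>lborel)"
    by (rule lborel_pair.Fubini_integral[symmetric]) (rule integrable_lborel_segment[OF g'])
  also have "\<dots> = (\<integral>t. indicator {0..1::real} t * (\<integral>x. g' x \<partial>lborel) \<partial>lborel)"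
    by (simp add: integral_lborel_translate)
  also have "\<dots> = (\<integral>x. g' x \<partial>lborel)"
    by simp
  finally show ?thesis ..
qed

text \<open>The weight \<open>l\<close> vanishes only on a hyperplane transversal to \<open>e\<close>; a point close to it is moved
  away by \<open>2e\<close>, and the increment is controlled by the derivative.\<close>

lemma integrable_of_weighted_and_derivative:
  fixes g g' l :: "'a::euclidean_space \<Rightarrow> real"
  assumes [measurable]: "g \<in> borel_measurable borel"
    and lg: "integrable lborel (\<lambda>x. l x * g x)" and l: "\<And>x t. l (x + t *\<^sub>R e) = l x + t"
    and g': "integrable lborel g'"
    and ac: "AE x in lborel. \<forall>a b. abs_continuous_on {a..b} (\<lambda>t. g (x + t *\<^sub>R e))"
    and der: "AE x in lborel. ((\<lambda>t. g (x + t *\<^sub>R e)) has_real_derivative g' x) (at 0)"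
  shows "integrable lborel g"
proof (rule Bochner_Integration.integrable_bound)
  \<comment> \<open>A majorant of \<open>g\<close>. Its first term suffices where
    \<open>\<bar>l x\<bar> \<ge> 1\<close>. Elsewhere \<open>l (x + 2 *\<^sub>R e) = l x + 2\<close>
    exceeds 1, so the second term bounds \<open>g\<close> at the moved point and the third bounds
    the increment.\<close>
  define B where "B x = \<bar>l x * g x\<bar> + \<bar>l (x + 2 *\<^sub>R e) * g (x + 2 *\<^sub>R e)\<bar>
      + (\<integral>t. indicator {0..2} t * \<bar>g' (x + t *\<^sub>R e)\<bar> \<partial>lborel)" for x
  have seg: "integrable (lborel \<Otimes>\<^sub>M lborel) (\<lambda>(x, t). indicator {0..2} t * \<bar>g' (x + t *\<^sub>R e)\<bar>)"
    by (rule integrable_lborel_segment) (use g' in simp)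
  show "integrable lborel B"
    unfolding B_def
    using lg integrable_lborel_translate[OF lg, of "2 *\<^sub>R e"] lborel_pair.integrable_fst[OF seg]
    by auto
  show "AE x in lborel. norm (g x) \<le> norm (B x)"
    using line_increment_eq_integral[OF g' _ ac der, of 2, simplified]
  proof eventually_elim
    case (elim x)
    define J where "J = (\<integral>t. indicator {0..2} t * \<bar>g' (x + t *\<^sub>R e)\<bar> \<partial>lborel)"
    have "\<bar>g (x + 2 *\<^sub>R e) - g x\<bar> \<le> (\<integral>t. \<bar>indicator {0..2} t * g' (x + t *\<^sub>R e)\<bar> \<partial>lborel)"
      unfolding elim by (rule integral_abs_bound)
    then have J: "\<bar>g (x + 2 *\<^sub>R e) - g x\<bar> \<le> J"
      by (simp add: J_def abs_mult)
    have J0: "J \<ge> 0"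
      unfolding J_def by (rule integral_nonneg_AE) simp
    show ?case
    proof (cases "\<bar>l x\<bar> \<ge> 1")
      case True
      then have "\<bar>g x\<bar> \<le> \<bar>l x * g x\<bar>"
        by (simp add: abs_mult mult_le_cancel_right1)
      then show ?thesis
        using J0 unfolding B_def J_def[symmetric] by simp
    next
      case False
      then have "\<bar>l (x + 2 *\<^sub>R e)\<bar> \<ge> 1"
        by (simp add: l)
      then have "\<bar>g (x + 2 *\<^sub>R e)\<bar> \<le> \<bar>l (x + 2 *\<^sub>R e) * g (x + 2 *\<^sub>R e)\<bar>"
        by (simp add: abs_mult mult_le_cancel_right1)
      moreover have "\<bar>l x * g x\<bar> \<ge> 0"
        by simp
      ultimately show ?thesis
        using J J0 unfolding B_def J_def[symmetric] real_norm_def by linarith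
    qed
  qed
qed simp

text \<open>On each line the weight is continuously differentiable, hence Lipschitz on compact
  intervals.\<close>

lemma abs_continuous_line_mult:
  fixes f w w' :: "'a::euclidean_space \<Rightarrow> real"
  assumes ac: "AE x in lborel. \<forall>a b. abs_continuous_on {a..b} (\<lambda>t. f (x + t *\<^sub>R e))"
    and w: "\<And>x. ((\<lambda>t. w (x + t *\<^sub>R e)) has_real_derivative w' x) (at 0)"
    and w': "continuous_on UNIV w'"
  shows "AE x in lborel. \<forall>a b. abs_continuous_on {a..b} (\<lambda>t. f (x + t *\<^sub>R e) * w (x + t *\<^sub>R e))"
  using ac
proof eventually_elim
  case (elim x)
  have "((\<lambda>\<tau>. w (x + \<tau> *\<^sub>R e)) has_real_derivative w' (x + t *\<^sub>R e)) (at t)" for t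
    using DERIV_shift[of "\<lambda>\<tau>. w (x + \<tau> *\<^sub>R e)" "w' (x + t *\<^sub>R e)" 0 t] w[of "x + t *\<^sub>R e"]
    by (simp add: algebra_simps)
  moreover have "continuous_on A (\<lambda>t. w' (x + t *\<^sub>R e))" for A
    by (intro continuous_on_compose2[OF w'] continuous_intros) auto
  ultimately show ?case
    using elim by (intro allI) (rule C1_lipschitz_on, auto intro: abs_continuous_on_mult_lipschitz)
qed

lemma AE_partial_deriv:
  assumes "ae_partials_exist f"
  shows "AE x in lborel. ((\<lambda>t. f (x + t *\<^sub>R axis k 1)) has_real_derivative partial_deriv k f x) (at 0)"
  using assms unfolding ae_partials_exist_def
  by eventually_elim (simp add: partial_deriv_def DERIV_deriv_iff_real_differentiable)

text \<open>The product \<open>f * w\<close> is integrable and absolutely continuous on almost every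
  line, so its derivative integrates to 0 and no boundary term arises.\<close>

lemma integration_by_parts_axis:
  fixes f w w' :: "real^'n \<Rightarrow> real"
  assumes f: "locally_abs_continuous f" "ae_partials_exist f"
    and w: "\<And>x. ((\<lambda>t. w (x + t *\<^sub>R axis k 1)) has_real_derivative w' x) (at 0)"
    and w': "continuous_on UNIV w'"
    and int: "integrable lborel (\<lambda>x. f x * w x)" "integrable lborel (\<lambda>x. partial_deriv k f x * w x)"
      "integrable lborel (\<lambda>x. f x * w' x)"
  shows "(\<integral>x. partial_deriv k f x * w x \<partial>lborel) = - (\<integral>x. f x * w' x \<partial>lborel)"
proof -
  have "(\<integral>x. partial_deriv k f x * w x + f x * w' x \<partial>lborel) = 0"
  proof (rule integral_directional_derivative_eq_0[OF int(1), where e = "axis k 1"])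
    show "integrable lborel (\<lambda>x. partial_deriv k f x * w x + f x * w' x)"
      using int by simp
    show "AE x in lborel. \<forall>a b. abs_continuous_on {a..b} (\<lambda>t. f (x + t *\<^sub>R axis k 1) * w (x + t *\<^sub>R axis k 1))"
      by (rule abs_continuous_line_mult[OF _ w w']) (use f in \<open>simp add: locally_abs_continuous_def\<close>)
    show "AE x in lborel. ((\<lambda>t. f (x + t *\<^sub>R axis k 1) * w (x + t *\<^sub>R axis k 1))
        has_real_derivative partial_deriv k f x * w x + f x * w' x) (at 0)"
      using AE_partial_deriv[OF f(2), of k]
      by eventually_elim (use w in \<open>auto intro!: derivative_eq_intros\<close>)
  qed
  then show ?thesis
    using int by simp
qed

section \<open>Gaussian weights\<close>

text \<open>The unnormalized Gaussian density with precision \<open>transpose R ** R\<close>.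
  Keeping a factor \<open>R\<close> of the precision lets both the inverse of \<open>C\<close> and
  the transpose of \<open>T\<close> take its place.\<close>

definition gauss_weight :: "real^'n^'m \<Rightarrow> real^'n \<Rightarrow> real^'n \<Rightarrow> real" where
  "gauss_weight R m x = exp (- (norm (R *v (x - m)))\<^sup>2 / 2)"

lemma continuous_on_matrix_vector_mult [continuous_intros]:
  fixes A :: "real^'n^'m"
  assumes "continuous_on S f"
  shows "continuous_on S (\<lambda>x. A *v f x)"
  by (rule bounded_linear.continuous_on[OF matrix_vector_mul_bounded_linear assms])

lemma continuous_on_gauss_weight [continuous_intros]:
  "continuous_on S (gauss_weight R m)"
  unfolding gauss_weight_def by (intro continuous_intros) auto

lemma borel_measurable_gauss_weight [measurable]: "gauss_weight R m \<in> borel_measurable borel"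
  by (intro borel_measurable_continuous_onI continuous_intros)

lemma inner_transpose_mult:
  fixes R :: "real^'n^'m"
  shows "x \<bullet> ((transpose R ** R) *v y) = (R *v x) \<bullet> (R *v y)"
  by (metis dot_lmul_matrix inner_commute matrix_vector_mul_assoc transpose_matrix_vector)

lemma gauss_weight_line_derivative:
  fixes R :: "real^'n^'m"
  shows "((\<lambda>t. gauss_weight R m (x + t *\<^sub>R axis k 1)) has_real_derivative
      - (((transpose R ** R) *v (x - m)) $ k) * gauss_weight R m x) (at 0)"
proof -
  define s e where "s = R *v (x - m)" and "e = R *v axis k 1"
  have line: "R *v (x + t *\<^sub>R axis k 1 - m) = s + t *\<^sub>R e" for t
    by (simp add: s_def e_def matrix_vector_right_distrib matrix_vector_mult_diff_distrib
        matrix_vector_mult_scaleR algebra_simps)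
  have "(norm (R *v (x + t *\<^sub>R axis k 1 - m)))\<^sup>2 = s \<bullet> s + 2 * t * (s \<bullet> e) + t\<^sup>2 * (e \<bullet> e)" for t
    unfolding line power2_norm_eq_inner
    by (simp add: inner_add inner_commute power2_eq_square algebra_simps)
  then have *: "gauss_weight R m (x + t *\<^sub>R axis k 1) = exp (- (s \<bullet> s + 2 * t * (s \<bullet> e) + t\<^sup>2 * (e \<bullet> e)) / 2)" for t
    by (simp add: gauss_weight_def)
  have "s \<bullet> e = ((transpose R ** R) *v (x - m)) $ k"
    using inner_transpose_mult[of "axis k 1" R "x - m"]
    by (simp add: s_def e_def inner_axis' inner_commute)
  then show ?thesis
    unfolding * using *[of 0] by (auto intro!: derivative_eq_intros)
qed

text \<open>The surplus \<open>b = 1 / 2 - a\<close> pays for the growth of \<open>p\<close>: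
  \<open>1 + Q\<close> is at most \<open>(1 + 1 / b) * (1 + b * Q)\<close>, hence at most
  \<open>(1 + 1 / b) * exp (b * Q)\<close>, and the product with \<open>exp (- Q / 2)\<close> is
  bounded by the wider Gaussian.\<close>

lemma integrable_mult_gauss:
  fixes h p Q :: "'a::euclidean_space \<Rightarrow> real"
  assumes [measurable]: "h \<in> borel_measurable borel" "p \<in> borel_measurable borel" "Q \<in> borel_measurable borel"
    and a: "a < 1 / 2" and int: "integrable lborel (\<lambda>x. h x * exp (- a * Q x))"
    and Q: "\<And>x. Q x \<ge> 0" and p: "\<And>x. \<bar>p x\<bar> \<le> K * (1 + Q x)"
  shows "integrable lborel (\<lambda>x. h x * p x * exp (- Q x / 2))"
proof -
  define b where "b = 1 / 2 - a"
  have b: "b > 0" using a by (simp add: b_def)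
  have K: "K \<ge> 0"
    using p[of undefined] Q[of undefined] by (smt (verit) zero_le_mult_iff)
  show ?thesis
  proof (rule Bochner_Integration.integrable_bound)
    show "integrable lborel (\<lambda>x. (K * (1 + 1 / b)) * (h x * exp (- a * Q x)))"
      using int by simp
    have "\<bar>h x * p x * exp (- Q x / 2)\<bar> \<le> \<bar>(K * (1 + 1 / b)) * (h x * exp (- a * Q x))\<bar>" for x
    proof -
      have "1 + Q x \<le> (1 + 1 / b) * (1 + b * Q x)"
        using b Q[of x] by (simp add: field_simps)
      also have "\<dots> \<le> (1 + 1 / b) * exp (b * Q x)"
        using b by (intro mult_left_mono exp_ge_add_one_self) auto
      finally have "\<bar>p x\<bar> \<le> K * ((1 + 1 / b) * exp (b * Q x))"
        using p[of x] K by (meson mult_left_mono order_trans)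
      then have "\<bar>p x\<bar> * exp (- Q x / 2) \<le> K * ((1 + 1 / b) * exp (b * Q x)) * exp (- Q x / 2)"
        by (rule mult_right_mono) simp
      also have "\<dots> = K * (1 + 1 / b) * exp (- a * Q x)"
        by (simp add: b_def mult_exp_exp algebra_simps diff_divide_distrib)
      finally have "\<bar>h x\<bar> * (\<bar>p x\<bar> * exp (- Q x / 2)) \<le> \<bar>h x\<bar> * (K * (1 + 1 / b) * exp (- a * Q x))"
        by (rule mult_left_mono) simp
      then show ?thesis
        using K b by (simp add: abs_mult mult.assoc mult.left_commute)
    qed
    then show "AE x in lborel. norm (h x * p x * exp (- Q x / 2)) \<le> norm ((K * (1 + 1 / b)) * (h x * exp (- a * Q x)))"
      by simp
  qed measurable
qed

lemma matrix_inv_eqI: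
  fixes A B :: "real^'n^'n"
  assumes "A ** B = mat 1"
  shows "matrix_inv A = B"
proof -
  have BA: "B ** A = mat 1"
    using assms by (simp add: matrix_left_right_inverse)
  then have "invertible A"
    using assms by (auto simp: invertible_def)
  then have "A ** matrix_inv A = mat 1"
    unfolding matrix_inv_def invertible_def by (rule someI_ex[THEN conjunct1])
  then show ?thesis
    by (metis BA matrix_mul_assoc matrix_mul_lid matrix_mul_rid)
qed

lemma mvn_density_eq_gauss_weight:
  fixes R S :: "real^'n^'n"
  assumes "S ** (transpose R ** R) = mat 1"
  shows "mvn_density m S x = \<bar>det R\<bar> / sqrt ((2 * pi) ^ CARD('n)) * gauss_weight R m x"
proof -
  have inv: "matrix_inv S = transpose R ** R"
    using assms by (rule matrix_inv_eqI)
  have "det S * (det R)\<^sup>2 = 1"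
    using arg_cong[OF assms, of det] by (simp add: det_mul power2_eq_square)
  then have "det R \<noteq> 0"
    by auto
  with \<open>det S * (det R)\<^sup>2 = 1\<close> have S: "det S = 1 / (det R)\<^sup>2"
    by (simp add: nonzero_eq_divide_eq)
  have "sqrt ((2 * pi) ^ CARD('n) * det S) = sqrt ((2 * pi) ^ CARD('n)) / \<bar>det R\<bar>"
    by (simp add: S real_sqrt_divide)
  then show ?thesis
    unfolding mvn_density_def inv inner_transpose_mult gauss_weight_def
    by (simp add: power2_norm_eq_inner)
qed

text \<open>These carry expectations over to Lebesgue integrals with an unnormalized weight, where
  integration by parts and domination take place.\<close>

lemma
  fixes R S :: "real^'n^'n" and f :: "real^'n \<Rightarrow> real"
  assumes R: "S ** (transpose R ** R) = mat 1" and f: "f \<in> borel_measurable borel"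
  shows integrable_mvn_iff: "integrable (mvn m S) f \<longleftrightarrow> integrable lborel (\<lambda>x. f x * gauss_weight R m x)"
    and integral_mvn: "(\<integral>x. f x \<partial>mvn m S) =
      \<bar>det R\<bar> / sqrt ((2 * pi) ^ CARD('n)) * (\<integral>x. f x * gauss_weight R m x \<partial>lborel)"
proof -
  define c where "c = \<bar>det R\<bar> / sqrt ((2 * pi) ^ CARD('n))"
  have "det R \<noteq> 0"
    using arg_cong[OF R, of det] by (auto simp: det_mul)
  then have c: "c > 0"
    by (simp add: c_def)
  have mvn: "mvn m S = density lborel (\<lambda>x. ennreal (c * gauss_weight R m x))"
    unfolding mvn_def mvn_density_eq_gauss_weight[OF R] c_def ..
  have nonneg: "0 \<le> c * gauss_weight R m x" for x
    using c by (simp add: gauss_weight_def)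
  have "integrable (mvn m S) f \<longleftrightarrow> integrable lborel (\<lambda>x. c * (f x * gauss_weight R m x))"
    unfolding mvn using f nonneg by (subst integrable_real_density) (auto simp: mult_ac)
  then show "integrable (mvn m S) f \<longleftrightarrow> integrable lborel (\<lambda>x. f x * gauss_weight R m x)"
    using c by simp
  have "(\<integral>x. f x \<partial>mvn m S) = (\<integral>x. c * (f x * gauss_weight R m x) \<partial>lborel)"
    unfolding mvn using f nonneg by (subst integral_real_density) (auto simp: mult_ac)
  then show "(\<integral>x. f x \<partial>mvn m S) = \<bar>det R\<bar> / sqrt ((2 * pi) ^ CARD('n)) * (\<integral>x. f x * gauss_weight R m x \<partial>lborel)"
    by (simp add: c_def)
qed

section \<open>Stein's identities\<close>

lemma vec_line: "(x + t *\<^sub>R axis k 1 - m) $ i = (x - m) $ i + t * (if i = k then 1 else 0)" for x :: "real^'n"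
  by (simp add: axis_def)

text \<open>Integration by parts against \<open>(x - m) $ i * q x\<close>. Its derivative in
  direction \<open>k\<close> has one term from the coordinate, present only for
  \<open>i = k\<close>, and one from the Gaussian, which expands over the row \<open>k\<close> of
  \<open>P\<close>.\<close>

lemma stein_first_order:
  fixes R :: "real^'n^'m" and h :: "real^'n \<Rightarrow> real" and m :: "real^'n"
  defines "P \<equiv> transpose R ** R" and "q \<equiv> gauss_weight R m"
  assumes h: "locally_abs_continuous h" "ae_partials_exist h"
    and int0: "integrable lborel (\<lambda>x. h x * q x)"
    and int1: "integrable lborel (\<lambda>x. h x * (x - m) $ i * q x)"
    and int2: "\<And>j. integrable lborel (\<lambda>x. h x * ((x - m) $ i * (x - m) $ j) * q x)"
    and intd: "integrable lborel (\<lambda>x. partial_deriv k h x * (x - m) $ i * q x)"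
  shows "(\<integral>x. partial_deriv k h x * (x - m) $ i * q x \<partial>lborel) =
    (\<Sum>j\<in>UNIV. P $ k $ j * (\<integral>x. h x * ((x - m) $ i * (x - m) $ j) * q x \<partial>lborel))
      - (if i = k then \<integral>x. h x * q x \<partial>lborel else 0)"
proof -
  define \<delta> where "\<delta> = (if i = k then 1 else (0::real))"
  let ?w = "\<lambda>x. (x - m) $ i * q x"
  let ?w' = "\<lambda>x. \<delta> * q x - (x - m) $ i * (P *v (x - m)) $ k * q x"
  have eq: "h x * ?w' x = \<delta> * (h x * q x) - (\<Sum>j\<in>UNIV. P $ k $ j * (h x * ((x - m) $ i * (x - m) $ j) * q x))" for x
    by (simp add: matrix_vector_mult_def sum_distrib_left sum_distrib_right algebra_simps)
  have "(\<integral>x. partial_deriv k h x * ?w x \<partial>lborel) = - (\<integral>x. h x * ?w' x \<partial>lborel)"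
  proof (rule integration_by_parts_axis[OF h])
    fix x
    have "((\<lambda>t. ((x - m) $ i + t * \<delta>) * q (x + t *\<^sub>R axis k 1)) has_real_derivative ?w' x) (at 0)"
      unfolding q_def P_def
      by (rule derivative_eq_intros gauss_weight_line_derivative refl)+ (simp add: algebra_simps)
    then show "((\<lambda>t. ?w (x + t *\<^sub>R axis k 1)) has_real_derivative ?w' x) (at 0)"
      by (simp only: vec_line \<delta>_def)
  next
    show "continuous_on UNIV ?w'"
      unfolding q_def by (intro continuous_intros)
    show "integrable lborel (\<lambda>x. h x * ?w x)" "integrable lborel (\<lambda>x. partial_deriv k h x * ?w x)"
      using int1 intd by (simp_all add: mult.assoc)
    show "integrable lborel (\<lambda>x. h x * ?w' x)"
      unfolding eq using int0 int2 by simp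
  qed
  also have "\<dots> = (\<Sum>j\<in>UNIV. P $ k $ j * (\<integral>x. h x * ((x - m) $ i * (x - m) $ j) * q x \<partial>lborel))
      - \<delta> * (\<integral>x. h x * q x \<partial>lborel)"
    unfolding eq using int0 int2 by simp
  finally show ?thesis
    by (simp add: mult.assoc \<delta>_def)
qed

text \<open>Integration by parts against \<open>q\<close> itself; it is meant for \<open>f\<close> a
  component of the gradient of \<open>h\<close>.\<close>

lemma stein_zeroth_order:
  fixes R :: "real^'n^'m" and f :: "real^'n \<Rightarrow> real" and m :: "real^'n"
  defines "P \<equiv> transpose R ** R" and "q \<equiv> gauss_weight R m"
  assumes f: "locally_abs_continuous f" "ae_partials_exist f" and [measurable]: "f \<in> borel_measurable borel"
    and int1: "\<And>i. integrable lborel (\<lambda>x. f x * (x - m) $ i * q x)"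
    and intd: "integrable lborel (\<lambda>x. partial_deriv k f x * q x)"
  shows "(\<integral>x. partial_deriv k f x * q x \<partial>lborel) =
    (\<Sum>i\<in>UNIV. P $ k $ i * (\<integral>x. f x * (x - m) $ i * q x \<partial>lborel))"
proof -
  let ?w' = "\<lambda>x. - (P *v (x - m)) $ k * q x"
  have eq: "f x * ?w' x = - (\<Sum>i\<in>UNIV. P $ k $ i * (f x * (x - m) $ i * q x))" for x
    by (simp add: matrix_vector_mult_def sum_distrib_left sum_distrib_right algebra_simps sum_negf)
  have w: "((\<lambda>t. q (x + t *\<^sub>R axis k 1)) has_real_derivative ?w' x) (at 0)" for x
    unfolding q_def P_def by (rule gauss_weight_line_derivative)
  have w': "continuous_on UNIV ?w'"
    unfolding q_def by (intro continuous_intros)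
  have intw': "integrable lborel (\<lambda>x. f x * ?w' x)"
    unfolding eq using int1 by simp
  \<comment> \<open>The assumptions on \<open>f\<close> carry a coordinate factor. The coordinate
    \<open>k\<close> grows at unit rate along \<open>axis k 1\<close>, so it can serve as the weight
    \<open>l\<close>, and integrability without the factor is recovered from that of the
    derivative.\<close>
  have intw: "integrable lborel (\<lambda>x. f x * q x)"
  proof (rule integrable_of_weighted_and_derivative[where e = "axis k 1" and l = "\<lambda>x. (x - m) $ k"])
    show "(\<lambda>x. f x * q x) \<in> borel_measurable borel"
      unfolding q_def by measurable
    show "integrable lborel (\<lambda>x. (x - m) $ k * (f x * q x))"
      using int1[of k] by (simp add: mult_ac)
    show "(x + t *\<^sub>R axis k 1 - m) $ k = (x - m) $ k + t" for x t
      by (simp add: axis_def)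
    show "integrable lborel (\<lambda>x. partial_deriv k f x * q x + f x * ?w' x)"
      using intd intw' by simp
    show "AE x in lborel. \<forall>a b. abs_continuous_on {a..b} (\<lambda>t. f (x + t *\<^sub>R axis k 1) * q (x + t *\<^sub>R axis k 1))"
      by (rule abs_continuous_line_mult[OF _ w w']) (use f in \<open>simp add: locally_abs_continuous_def\<close>)
    show "AE x in lborel. ((\<lambda>t. f (x + t *\<^sub>R axis k 1) * q (x + t *\<^sub>R axis k 1))
        has_real_derivative partial_deriv k f x * q x + f x * ?w' x) (at 0)"
      using AE_partial_deriv[OF f(2), of k]
      by eventually_elim (use w in \<open>auto intro!: derivative_eq_intros\<close>)
  qed
  have "(\<integral>x. partial_deriv k f x * q x \<partial>lborel) = - (\<integral>x. f x * ?w' x \<partial>lborel)"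
    by (rule integration_by_parts_axis[OF f w w' intw intd intw'])
  then show ?thesis
    unfolding eq using int1 by simp
qed

section \<open>Differentiating Gaussian integrals in the factors of the covariance and the precision\<close>

text \<open>The Lagrange remainder is \<open>exp t / 2 * y\<^sup>2\<close> with \<open>t\<close> no
  larger than \<open>y\<close> in absolute value.\<close>

lemma abs_exp_minus_linear_le: "\<bar>exp y - 1 - y\<bar> \<le> y\<^sup>2 * exp \<bar>y\<bar>" for y :: real
proof -
  obtain t where t: "\<bar>t\<bar> \<le> \<bar>y\<bar>" "exp y = (\<Sum>m<2. y ^ m / fact m) + exp t / fact 2 * y ^ 2"
    using Maclaurin_exp_le[of y 2] by auto
  then have "exp y - 1 - y = exp t / 2 * y\<^sup>2"
    by (simp add: numeral_2_eq_2)
  moreover have "exp t / 2 * y\<^sup>2 \<le> exp \<bar>y\<bar> * y\<^sup>2"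
  proof (rule mult_right_mono)
    have "exp t \<le> exp \<bar>y\<bar>"
      using t(1) by simp
    then show "exp t / 2 \<le> exp \<bar>y\<bar>"
      using exp_ge_zero[of t] by linarith
  qed simp
  moreover have "0 \<le> exp t / 2 * y\<^sup>2"
    by simp
  ultimately show ?thesis
    by (simp only: abs_of_nonneg mult.commute[of "y\<^sup>2"])
qed

lemma has_real_derivative_at_0_quadratic:
  fixes F :: "real \<Rightarrow> real"
  assumes "\<forall>\<^sub>F r in at 0. \<bar>F r - F 0 - r * D\<bar> \<le> B * r\<^sup>2"
  shows "(F has_real_derivative D) (at 0)"
proof -
  have "((\<lambda>r. (F r - F 0) / r - D) \<longlongrightarrow> 0) (at 0)"
  proof (rule Lim_null_comparison)
    show "\<forall>\<^sub>F r in at 0. norm ((F r - F 0) / r - D) \<le> B * \<bar>r\<bar>"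
      using assms eventually_neq_at_within[of 0 0 UNIV]
    proof eventually_elim
      case (elim r)
      have "norm ((F r - F 0) / r - D) = \<bar>F r - F 0 - r * D\<bar> / \<bar>r\<bar>"
        using elim(2) by (simp add: abs_divide[symmetric] diff_divide_distrib)
      also have "\<dots> \<le> B * r\<^sup>2 / \<bar>r\<bar>"
        using elim(1) by (rule divide_right_mono) simp
      also have "\<dots> = B * \<bar>r\<bar>"
        using elim(2) by (simp add: power2_eq_square abs_if)
      finally show ?case .
    qed
    show "((\<lambda>r. B * \<bar>r\<bar>) \<longlongrightarrow> 0) (at 0)"
      by (auto intro!: tendsto_eq_intros)
  qed
  then show ?thesis
    by (simp add: has_field_derivative_iff LIM_zero_cancel)
qed

text \<open>A first-order expansion in \<open>r\<close> whose error is \<open>r\<^sup>2\<close>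
  times a fixed multiple of the wider Gaussian. The restriction on \<open>r\<close> keeps the change
  of the exponent below \<open>b * Q / 2\<close>, half of the surplus; the other half absorbs the
  factor \<open>Q\<^sup>2\<close> of the Taylor remainder.\<close>

lemma exp_tilt_remainder:
  fixes a b K Q L M r :: real
  assumes b: "b = 1 / 2 - a" "b > 0" and K: "K > 0" and Q: "Q \<ge> 0"
    and L: "\<bar>L\<bar> \<le> K * Q" and M: "0 \<le> M" "M \<le> K * Q"
    and r: "\<bar>r\<bar> \<le> 1" "4 * \<bar>r\<bar> * K \<le> b"
  shows "\<bar>exp (- (Q + 2 * r * L + r\<^sup>2 * M) / 2) - exp (- Q / 2) + r * (L * exp (- Q / 2))\<bar>
    \<le> r\<^sup>2 * (32 * K\<^sup>2 / b\<^sup>2 + K / (2 * b)) * exp (- a * Q)"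
proof -
  \<comment> \<open>The change of the exponent caused by the tilt.\<close>
  define y where "y = - r * L - r\<^sup>2 * M / 2"
  have KQ: "K * Q \<ge> 0"
    using K Q by simp
  have r2: "r\<^sup>2 \<le> \<bar>r\<bar>"
    using r(1) by (metis abs_ge_zero abs_mult_self_eq mult_left_le power2_eq_square)
  have "\<bar>y\<bar> \<le> \<bar>r\<bar> * \<bar>L\<bar> + r\<^sup>2 * M / 2"
    unfolding y_def using M(1) abs_triangle_ineq4[of "- r * L" "r\<^sup>2 * M / 2"] by (simp add: abs_mult)
  also have "\<dots> \<le> \<bar>r\<bar> * (K * Q) + \<bar>r\<bar> * (K * Q) / 2"
    using L M r2 by (intro add_mono mult_mono divide_right_mono) auto
  also have "\<dots> \<le> 2 * \<bar>r\<bar> * (K * Q)"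
    using mult_nonneg_nonneg[OF abs_ge_zero[of r] KQ] by linarith
  finally have y1: "\<bar>y\<bar> \<le> 2 * \<bar>r\<bar> * (K * Q)" .
  have "2 * \<bar>r\<bar> * (K * Q) \<le> b * Q / 2"
    using mult_right_mono[OF r(2) Q] by (simp add: algebra_simps)
  with y1 have y2: "\<bar>y\<bar> \<le> b * Q / 2"
    by linarith
  have "y\<^sup>2 \<le> (2 * \<bar>r\<bar> * (K * Q))\<^sup>2"
    using y1 by (metis abs_ge_zero power2_abs power_mono)
  then have y3: "y\<^sup>2 \<le> 4 * r\<^sup>2 * K\<^sup>2 * Q\<^sup>2"
    by (simp add: power_mult_distrib)
  \<comment> \<open>This is \<open>z\<^sup>2 / 2 \<le> exp z\<close> at
    \<open>z = b * Q / 2\<close>; the resulting 8, times the 4 from the square of the bound on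
    \<open>y\<close>, gives the constant 32.\<close>
  have z: "Q\<^sup>2 \<le> 8 / b\<^sup>2 * exp (b * Q / 2)"
  proof -
    have "(b * Q / 2)\<^sup>2 / 2 \<le> exp (b * Q / 2)"
      using exp_lower_Taylor_quadratic[of "b * Q / 2"] mult_nonneg_nonneg[OF less_imp_le[OF b(2)] Q]
      by linarith
    then show ?thesis
      using b(2) by (simp add: field_simps power2_eq_square)
  qed
  have "y\<^sup>2 * exp \<bar>y\<bar> \<le> (4 * r\<^sup>2 * K\<^sup>2 * Q\<^sup>2) * exp (b * Q / 2)"
    using y2 y3 by (intro mult_mono) auto
  also have "\<dots> \<le> (4 * r\<^sup>2 * K\<^sup>2 * (8 / b\<^sup>2 * exp (b * Q / 2))) * exp (b * Q / 2)"
    using z by (intro mult_right_mono mult_left_mono) auto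
  also have "\<dots> = r\<^sup>2 * (32 * K\<^sup>2 / b\<^sup>2) * exp (b * Q)"
    by (simp add: mult_exp_exp)
  finally have e1: "y\<^sup>2 * exp \<bar>y\<bar> \<le> r\<^sup>2 * (32 * K\<^sup>2 / b\<^sup>2) * exp (b * Q)" .
  have "b * Q \<le> exp (b * Q)"
    using exp_ge_add_one_self[of "b * Q"] by linarith
  then have "Q \<le> exp (b * Q) / b"
    using b(2) by (simp add: field_simps)
  then have "M \<le> K * (exp (b * Q) / b)"
    using M(2) K by (meson mult_left_mono order_trans less_imp_le)
  then have "r\<^sup>2 / 2 * M \<le> r\<^sup>2 / 2 * (K * (exp (b * Q) / b))"
    by (rule mult_left_mono) simp
  then have e2: "r\<^sup>2 * M / 2 \<le> r\<^sup>2 * (K / (2 * b)) * exp (b * Q)"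
    by simp
  \<comment> \<open>The linear term of the tilt is \<open>- r * L\<close>; the rest of
    \<open>y\<close> is already of order \<open>r\<^sup>2\<close> and is estimated by
    \<open>e2\<close>.\<close>
  have "exp y - 1 + r * L = (exp y - 1 - y) - r\<^sup>2 * M / 2"
    by (simp add: y_def)
  then have "\<bar>exp y - 1 + r * L\<bar> \<le> \<bar>exp y - 1 - y\<bar> + r\<^sup>2 * M / 2"
    using abs_triangle_ineq4[of "exp y - 1 - y" "r\<^sup>2 * M / 2"] M(1) by simp
  also have "\<dots> \<le> y\<^sup>2 * exp \<bar>y\<bar> + r\<^sup>2 * M / 2"
    using abs_exp_minus_linear_le by simp
  also have "\<dots> \<le> r\<^sup>2 * (32 * K\<^sup>2 / b\<^sup>2 + K / (2 * b)) * exp (b * Q)"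
    using add_mono[OF e1 e2] by (simp only: distrib_left distrib_right)
  finally have "\<bar>exp y - 1 + r * L\<bar> * exp (- Q / 2) \<le> r\<^sup>2 * (32 * K\<^sup>2 / b\<^sup>2 + K / (2 * b)) * exp (b * Q) * exp (- Q / 2)"
    by (rule mult_right_mono) simp
  also have "\<dots> = r\<^sup>2 * (32 * K\<^sup>2 / b\<^sup>2 + K / (2 * b)) * exp (- a * Q)"
    unfolding mult.assoc mult_exp_exp by (simp add: b(1) algebra_simps)
  also have "\<bar>exp y - 1 + r * L\<bar> * exp (- Q / 2) = \<bar>(exp y - 1 + r * L) * exp (- Q / 2)\<bar>"
    by (simp add: abs_mult)
  also have "(exp y - 1 + r * L) * exp (- Q / 2) = exp (y + - Q / 2) - exp (- Q / 2) + r * (L * exp (- Q / 2))"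
    unfolding exp_add by (simp add: algebra_simps)
  also have "y + - Q / 2 = - (Q + 2 * r * L + r\<^sup>2 * M) / 2"
    by (simp add: y_def field_simps)
  finally show ?thesis .
qed

text \<open>Differentiation under the integral in quantitative form: for small \<open>r\<close> the
  pointwise remainder is at most \<open>r\<^sup>2\<close> times a fixed integrable function, so the
  remainder of the integral is quadratic in \<open>r\<close>.\<close>

lemma gauss_tilt_has_derivative:
  fixes h Q L M :: "'a::euclidean_space \<Rightarrow> real"
  assumes [measurable]: "h \<in> borel_measurable borel" "Q \<in> borel_measurable borel"
      "L \<in> borel_measurable borel" "M \<in> borel_measurable borel"
    and a: "a < 1 / 2" and int: "integrable lborel (\<lambda>x. h x * exp (- a * Q x))"
    and K: "K > 0" and Q: "\<And>x. Q x \<ge> 0" and L: "\<And>x. \<bar>L x\<bar> \<le> K * Q x"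
    and M: "\<And>x. 0 \<le> M x" "\<And>x. M x \<le> K * Q x"
  shows "((\<lambda>r. \<integral>x. h x * exp (- (Q x + 2 * r * L x + r\<^sup>2 * M x) / 2) \<partial>lborel)
    has_real_derivative - (\<integral>x. h x * L x * exp (- Q x / 2) \<partial>lborel)) (at 0)"
proof (rule has_real_derivative_at_0_quadratic)
  define b where "b = 1 / 2 - a"
  have b: "b > 0" using a by (simp add: b_def)
  define B where "B = 32 * K\<^sup>2 / b\<^sup>2 + K / (2 * b)"
  have B: "B \<ge> 0"
    using b K by (simp add: B_def)
  let ?F = "\<lambda>r. \<integral>x. h x * exp (- (Q x + 2 * r * L x + r\<^sup>2 * M x) / 2) \<partial>lborel"
  let ?R = "\<lambda>r x. h x * (exp (- (Q x + 2 * r * L x + r\<^sup>2 * M x) / 2) - exp (- Q x / 2) + r * (L x * exp (- Q x / 2)))"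
  have int0: "integrable lborel (\<lambda>x. h x * exp (- Q x / 2))"
    using integrable_mult_gauss[OF _ _ _ a int Q, of "\<lambda>_. 1" 1] Q by simp
  have "\<bar>L x\<bar> \<le> K * (1 + Q x)" for x
    using L[of x] K by (simp add: distrib_left add_increasing)
  then have intL: "integrable lborel (\<lambda>x. h x * L x * exp (- Q x / 2))"
    by (intro integrable_mult_gauss[OF _ _ _ a int Q]) auto
  have "\<forall>\<^sub>F r in at 0. \<bar>r\<bar> < min 1 (b / (4 * K))"
    using b K by (intro eventually_at_in_open'[of "ball 0 (min 1 (b / (4 * K)))", THEN eventually_mono]) auto
  then show "\<forall>\<^sub>F r in at 0. \<bar>?F r - ?F 0 - r * - (\<integral>x. h x * L x * exp (- Q x / 2) \<partial>lborel)\<bar>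
      \<le> B * (\<integral>x. \<bar>h x * exp (- a * Q x)\<bar> \<partial>lborel) * r\<^sup>2"
  proof eventually_elim
    case (elim r)
    then have r: "\<bar>r\<bar> \<le> 1" "4 * \<bar>r\<bar> * K \<le> b"
      using K by (auto simp: field_simps)
    have bound: "\<bar>?R r x\<bar> \<le> r\<^sup>2 * B * \<bar>h x * exp (- a * Q x)\<bar>" for x
    proof -
      have "\<bar>?R r x\<bar> \<le> \<bar>h x\<bar> * (r\<^sup>2 * B * exp (- a * Q x))"
        unfolding abs_mult B_def
        by (intro mult_left_mono exp_tilt_remainder[OF b_def b K Q L M r]) simp
      then show ?thesis
        by (simp add: abs_mult mult_ac)
    qed
    have intR: "integrable lborel (?R r)"
    proof (rule Bochner_Integration.integrable_bound)
      show "integrable lborel (\<lambda>x. r\<^sup>2 * B * \<bar>h x * exp (- a * Q x)\<bar>)"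
        using int by simp
      show "AE x in lborel. norm (?R r x) \<le> norm (r\<^sup>2 * B * \<bar>h x * exp (- a * Q x)\<bar>)"
        using bound B by (simp add: abs_mult)
    qed measurable
    have "(\<lambda>x. ?R r x + h x * exp (- Q x / 2) - r * (h x * L x * exp (- Q x / 2)))
        = (\<lambda>x. h x * exp (- (Q x + 2 * r * L x + r\<^sup>2 * M x) / 2))"
      by (simp add: fun_eq_iff algebra_simps)
    moreover have "(\<integral>x. ?R r x + h x * exp (- Q x / 2) - r * (h x * L x * exp (- Q x / 2)) \<partial>lborel) =
        (\<integral>x. ?R r x \<partial>lborel) + (\<integral>x. h x * exp (- Q x / 2) \<partial>lborel) - r * (\<integral>x. h x * L x * exp (- Q x / 2) \<partial>lborel)"
      using intR int0 intL by simp
    ultimately have "?F r - ?F 0 - r * - (\<integral>x. h x * L x * exp (- Q x / 2) \<partial>lborel) = (\<integral>x. ?R r x \<partial>lborel)"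
      by simp
    moreover have "\<bar>\<integral>x. ?R r x \<partial>lborel\<bar> \<le> (\<integral>x. r\<^sup>2 * B * \<bar>h x * exp (- a * Q x)\<bar> \<partial>lborel)"
      by (rule integral_abs_bound[THEN order_trans], rule integral_mono)
        (use intR int bound in auto)
    ultimately show ?case
      by (simp add: mult_ac)
  qed
qed

lemma matrix_unit_mult_vec: "axis i (axis j 1) *v v = v $ j *\<^sub>R axis i (1::real)"
  by (simp add: vec_eq_iff matrix_vector_mult_def axis_def if_distrib[of "\<lambda>u. u $ _"]
      if_distrib[of "\<lambda>z. z * _"] cong: if_cong)

text \<open>Only column \<open>j\<close> changes, and the new column is \<open>A *v x\<close> with
  \<open>x\<close> equal to \<open>axis j 1\<close> plus \<open>t\<close> times column
  \<open>i\<close> of the inverse. By Cramer's rule the determinant is multiplied by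
  \<open>x $ j\<close>.\<close>

lemma det_add_matrix_unit:
  fixes A B :: "real^'n^'n"
  assumes "A ** B = mat 1"
  shows "det (A + t *\<^sub>R axis i (axis j 1)) = (1 + t * B $ j $ i) * det A"
proof -
  define x where "x = axis j 1 + t *\<^sub>R (B *v axis i 1)"
  have "A *v (B *v axis i 1) = axis i 1"
    by (simp only: matrix_vector_mul_assoc assms matrix_vector_mul_lid)
  then have "A *v x = column j A + t *\<^sub>R axis i 1"
    unfolding x_def by (simp only: matrix_vector_right_distrib matrix_vector_mult_scaleR matrix_vector_mult_basis[of A])
  then have "A + t *\<^sub>R axis i (axis j 1) = (\<chi> a b. if b = j then (A *v x) $ a else A $ a $ b)"
    by (auto simp: vec_eq_iff column_def axis_def)
  moreover have "x $ j = 1 + t * B $ j $ i"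
    by (simp add: x_def matrix_vector_mult_basis column_def)
  ultimately show ?thesis
    using cramer_lemma[of j A x] by simp
qed

text \<open>Since \<open>R\<close> has a left inverse, \<open>A *v v\<close> is a fixed linear image
  of \<open>R *v v\<close>, and likewise for \<open>B\<close>. This bounds every quadratic
  expression in \<open>v\<close> by the exponent of the Gaussian.\<close>

lemma quadratic_form_bound:
  fixes R A B :: "real^'n^'n"
  assumes "R' ** R = mat 1"
  obtains K where "K > 0" "\<And>v. \<bar>(A *v v) $ i * (B *v v) $ j\<bar> \<le> K * (norm (R *v v))\<^sup>2"
proof -
  have *: "\<exists>K>0. \<forall>v. norm (A *v v) \<le> norm (R *v v) * K" for A :: "real^'n^'n"
  proof -
    obtain K where "K > 0" "\<And>v. norm ((A ** R') *v v) \<le> norm v * K"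
      using bounded_linear.pos_bounded[OF matrix_vector_mul_bounded_linear[of "A ** R'"]] by blast
    moreover have "(A ** R') *v (R *v v) = A *v v" for v
      by (metis assms matrix_mul_assoc matrix_mul_rid matrix_vector_mul_assoc)
    ultimately show ?thesis
      by metis
  qed
  obtain K1 K2 where K: "K1 > 0" "\<And>v. norm (A *v v) \<le> norm (R *v v) * K1"
    "K2 > 0" "\<And>v. norm (B *v v) \<le> norm (R *v v) * K2"
    using *[of A] *[of B] by blast
  show ?thesis
  proof
    show "K1 * K2 > 0"
      using K by simp
    fix v
    have "\<bar>(A *v v) $ i\<bar> * \<bar>(B *v v) $ j\<bar> \<le> (norm (R *v v) * K1) * (norm (R *v v) * K2)"
      using K(2,4)[of v] component_le_norm_cart[of "A *v v" i] component_le_norm_cart[of "B *v v" j] K(1)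
      by (intro mult_mono) auto
    then show "\<bar>(A *v v) $ i * (B *v v) $ j\<bar> \<le> K1 * K2 * (norm (R *v v))\<^sup>2"
      by (simp add: abs_mult power2_eq_square mult_ac)
  qed
qed

text \<open>The common frame for both factors. Near \<open>t = 0\<close> the normalizing constant
  acquires a factor \<open>\<alpha> t\<close> and the quadratic form is tilted with parameter
  \<open>\<rho> t\<close>; the product and chain rules combine \<open>\<alpha>'\<close> with the
  derivative of the tilted integral.\<close>

lemma integral_mvn_has_derivative:
  fixes h :: "real^'n \<Rightarrow> real" and R S :: "real^'n^'n" and L M :: "real^'n \<Rightarrow> real"
  assumes h: "h \<in> borel_measurable borel" and R: "S ** (transpose R ** R) = mat 1"
    and a: "a < 1 / 2" and int: "integrable lborel (\<lambda>x. h x * exp (- a * (norm (R *v (x - m)))\<^sup>2))"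
    and S': "\<forall>\<^sub>F t in nhds 0. S' t ** (transpose (R' t) ** R' t) = mat 1 \<and> \<bar>det (R' t)\<bar> = \<alpha> t * \<bar>det R\<bar> \<and>
      (\<forall>v. (norm (R' t *v v))\<^sup>2 = (norm (R *v v))\<^sup>2 + 2 * \<rho> t * L v + (\<rho> t)\<^sup>2 * M v)"
    and \<alpha>: "\<alpha> 0 = 1" "(\<alpha> has_real_derivative \<alpha>') (at 0)"
    and \<rho>: "\<rho> 0 = 0" "(\<rho> has_real_derivative 1) (at 0)"
    and L: "continuous_on UNIV L" "\<And>v. \<bar>L v\<bar> \<le> K * (norm (R *v v))\<^sup>2"
    and M: "continuous_on UNIV M" "\<And>v. 0 \<le> M v" "\<And>v. M v \<le> K * (norm (R *v v))\<^sup>2"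
    and K: "K > 0"
  shows "((\<lambda>t. \<integral>x. h x \<partial>mvn m (S' t)) has_real_derivative
    \<alpha>' * (\<integral>x. h x \<partial>mvn m S) - (\<integral>x. h x * L (x - m) \<partial>mvn m S)) (at 0)"
proof -
  define c where "c = \<bar>det R\<bar> / sqrt ((2 * pi) ^ CARD('n))"
  define Q where "Q x = (norm (R *v (x - m)))\<^sup>2" for x
  \<comment> \<open>The unnormalized integral as a function of the tilt parameter alone; the
    expectation equals \<open>c * (\<alpha> t * \<Phi> (\<rho> t))\<close> for \<open>t\<close> near
    0.\<close>
  define \<Phi> where "\<Phi> r = (\<integral>x. h x * exp (- (Q x + 2 * r * L (x - m) + r\<^sup>2 * M (x - m)) / 2) \<partial>lborel)" for r
  have meas: "(\<lambda>x. L (x - m)) \<in> borel_measurable borel" "(\<lambda>x. M (x - m)) \<in> borel_measurable borel"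
    "Q \<in> borel_measurable borel"
    unfolding Q_def
    by (intro borel_measurable_continuous_onI continuous_intros continuous_on_compose2[OF L(1)]
        continuous_on_compose2[OF M(1)]; simp)+
  have \<Phi>: "(\<Phi> has_real_derivative - (\<integral>x. h x * L (x - m) * exp (- Q x / 2) \<partial>lborel)) (at 0)"
    unfolding \<Phi>_def
    by (rule gauss_tilt_has_derivative[OF h meas(3,1,2) a _ K]) (use int L M in \<open>auto simp: Q_def\<close>)
  have "(\<Phi> has_real_derivative - (\<integral>x. h x * L (x - m) * exp (- Q x / 2) \<partial>lborel)) (at (\<rho> 0))"
    using \<Phi> \<rho>(1) by simp
  from DERIV_chain2[OF this \<rho>(2)]
  have "((\<lambda>t. c * (\<alpha> t * \<Phi> (\<rho> t))) has_real_derivative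
      c * (\<alpha>' * \<Phi> 0 - (\<integral>x. h x * L (x - m) * exp (- Q x / 2) \<partial>lborel))) (at 0)"
    using \<alpha> \<rho>(1) by (auto intro!: derivative_eq_intros)
  moreover have "\<forall>\<^sub>F t in nhds 0. (\<integral>x. h x \<partial>mvn m (S' t)) = c * (\<alpha> t * \<Phi> (\<rho> t))"
    using S'
  proof eventually_elim
    case (elim t)
    then have "(\<integral>x. h x \<partial>mvn m (S' t)) = \<bar>det (R' t)\<bar> / sqrt ((2 * pi) ^ CARD('n)) * (\<integral>x. h x * gauss_weight (R' t) m x \<partial>lborel)"
      by (intro integral_mvn h) blast
    also have "(\<integral>x. h x * gauss_weight (R' t) m x \<partial>lborel) = \<Phi> (\<rho> t)"
      using elim by (simp add: \<Phi>_def gauss_weight_def Q_def)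
    finally show ?case
      using elim by (simp add: c_def)
  qed
  moreover have "c * (\<alpha>' * \<Phi> 0 - (\<integral>x. h x * L (x - m) * exp (- Q x / 2) \<partial>lborel)) =
      \<alpha>' * (\<integral>x. h x \<partial>mvn m S) - (\<integral>x. h x * L (x - m) \<partial>mvn m S)"
    using integral_mvn[OF R h, of m] integral_mvn[OF R, of "\<lambda>x. h x * L (x - m)" m] h meas
    by (simp add: c_def \<Phi>_def gauss_weight_def Q_def algebra_simps)
  ultimately show ?thesis
    by (simp add: DERIV_cong_ev)
qed

text \<open>The inverse of a covariance factor is thereby an admissible \<open>R\<close> for the
  Gaussian weight.\<close>

lemma gram_mult_inverse_gram:
  fixes A B :: "real^'n^'n"
  assumes "B ** A = mat 1"
  shows "A ** transpose A ** (transpose B ** B) = mat 1"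
proof -
  have "transpose A ** transpose B = mat 1"
    by (metis assms matrix_transpose_mul transpose_mat)
  then have "A ** transpose A ** (transpose B ** B) = A ** B"
    by (metis matrix_mul_assoc matrix_mul_rid)
  then show ?thesis
    using assms by (simp add: matrix_left_right_inverse)
qed

lemma norm_diff_scaleR_square:
  "(norm (w - c *\<^sub>R u))\<^sup>2 = (norm w)\<^sup>2 - 2 * c * (u \<bullet> w) + c\<^sup>2 * (norm u)\<^sup>2"
  for w u :: "'a::real_inner"
  unfolding power2_norm_eq_inner
  by (simp add: inner_diff inner_commute power2_eq_square algebra_simps)

text \<open>By the Sherman--Morrison formula the inverse of \<open>C + t E\<^sub>i\<^sub>j\<close> is \<open>D - \<rho> (D e\<^sub>i) (D\<^sup>T e\<^sub>j)\<^sup>T\<close>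
  with \<open>D = C\<^sup>-\<^sup>1\<close> and \<open>\<rho> = t / (1 + t D\<^sub>j\<^sub>i)\<close>.\<close>

lemma integral_mvn_derivative_cov_factor:
  fixes C D :: "real^'n^'n" and h :: "real^'n \<Rightarrow> real"
  assumes h: "h \<in> borel_measurable borel" and CD: "C ** D = mat 1"
    and a: "a < 1 / 2" and int: "integrable lborel (\<lambda>x. h x * exp (- a * (norm (D *v (x - m)))\<^sup>2))"
  shows "((\<lambda>t. \<integral>x. h x \<partial>mvn m ((C + t *\<^sub>R axis i (axis j 1)) ** transpose (C + t *\<^sub>R axis i (axis j 1))))
    has_real_derivative
      - D $ j $ i * (\<integral>x. h x \<partial>mvn m (C ** transpose C)) +
      (\<integral>x. h x * ((D *v (x - m)) $ j * ((transpose D ** D) *v (x - m)) $ i) \<partial>mvn m (C ** transpose C))) (at 0)"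
proof -
  define P where "P = transpose D ** D"
  define d where "d = D $ j $ i"
  define u where "u = D *v axis i 1"
  define C' where "C' t = C + t *\<^sub>R axis i (axis j 1)" for t
  define \<rho> where "\<rho> t = t / (1 + t * d)" for t
  define D' where "D' t = D - \<rho> t *\<^sub>R (\<chi> k l. u $ k * D $ j $ l)" for t
  \<comment> \<open>Read off from expanding the square of the norm of
    \<open>D *v v - (\<rho> t * (D *v v) $ j) *\<^sub>R u\<close>; the inner product of
    \<open>u\<close> with \<open>D *v v\<close> is \<open>(P *v v) $ i\<close>.\<close>
  define L where "L v = - ((D *v v) $ j * (P *v v) $ i)" for v
  define M where "M v = (norm u)\<^sup>2 * ((D *v v) $ j * (D *v v) $ j)" for v
  have DC: "D ** C = mat 1"
    using CD by (simp add: matrix_left_right_inverse)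
  have D': "D' t *v v = D *v v - (\<rho> t * (D *v v) $ j) *\<^sub>R u" for t v
    by (simp add: D'_def vec_eq_iff matrix_vector_mult_def sum_subtractf
        sum_distrib_left algebra_simps)
  have C': "C' t *v v = C *v v + (t * v $ j) *\<^sub>R axis i 1" for t v
    by (simp add: C'_def matrix_vector_mult_add_rdistrib matrix_unit_mult_vec
        scaleR_matrix_vector_assoc[symmetric])
  have inv: "D' t ** C' t = mat 1" if t: "1 + t * d > 0" for t
  proof -
    have "D' t *v (C' t *v v) = v" for v
    proof -
      have "D *v (C' t *v v) = v + (t * v $ j) *\<^sub>R u"
        by (simp add: C' matrix_vector_right_distrib matrix_vector_mult_scaleR matrix_vector_mul_assoc DC u_def)
      moreover from this have "(D *v (C' t *v v)) $ j = v $ j * (1 + t * d)"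
        by (simp add: u_def d_def matrix_vector_mult_basis column_def algebra_simps)
      ultimately show ?thesis
        using t by (simp add: D' \<rho>_def mult.commute)
    qed
    then show ?thesis
      by (simp add: matrix_eq matrix_vector_mul_assoc[symmetric])
  qed
  have ui: "u \<bullet> (D *v v) = (P *v v) $ i" for v
    using inner_transpose_mult[of "axis i 1" D v] by (simp add: u_def P_def inner_axis')
  obtain K1 where K1: "K1 > 0" "\<And>v. \<bar>(D *v v) $ j * (P *v v) $ i\<bar> \<le> K1 * (norm (D *v v))\<^sup>2"
    using quadratic_form_bound[OF CD] by blast
  obtain K2 where K2: "K2 > 0" "\<And>v. \<bar>(D *v v) $ j * (D *v v) $ j\<bar> \<le> K2 * (norm (D *v v))\<^sup>2"
    using quadratic_form_bound[OF CD] by blast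
  define K where "K = K1 + (norm u)\<^sup>2 * K2"
  have "((\<lambda>t. \<integral>x. h x \<partial>mvn m (C' t ** transpose (C' t))) has_real_derivative
      - d * (\<integral>x. h x \<partial>mvn m (C ** transpose C)) - (\<integral>x. h x * L (x - m) \<partial>mvn m (C ** transpose C))) (at 0)"
  proof (rule integral_mvn_has_derivative[OF h _ a int, where \<alpha> = "\<lambda>t. 1 / (1 + t * d)" and \<rho> = \<rho> and R' = D' and M = M and K = K])
    show "C ** transpose C ** (transpose D ** D) = mat 1"
      by (rule gram_mult_inverse_gram[OF DC])
    have "\<forall>\<^sub>F t in nhds 0. 1 + t * d > 0"
      by (rule order_tendstoD(1)[where y = 1]) (auto intro!: tendsto_eq_intros filterlim_ident)
    then show "\<forall>\<^sub>F t in nhds 0. C' t ** transpose (C' t) ** (transpose (D' t) ** D' t) = mat 1 \<and>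
        \<bar>det (D' t)\<bar> = 1 / (1 + t * d) * \<bar>det D\<bar> \<and>
        (\<forall>v. (norm (D' t *v v))\<^sup>2 = (norm (D *v v))\<^sup>2 + 2 * \<rho> t * L v + (\<rho> t)\<^sup>2 * M v)"
    proof eventually_elim
      case (elim t)
      \<comment> \<open>The determinant of \<open>D' t\<close> follows from that of
        \<open>C' t\<close>; positivity of \<open>1 + t * d\<close> lets this factor leave the
        absolute value.\<close>
      have "det (D' t) * det (C' t) = 1" "det D * det C = 1"
        using arg_cong[OF inv[OF elim], of det] arg_cong[OF DC, of det] by (simp_all add: det_mul)
      moreover have "det (C' t) = (1 + t * d) * det C"
        unfolding C'_def d_def by (rule det_add_matrix_unit[OF CD])
      ultimately have "det (D' t) * (1 + t * d) * det C = det D * det C"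
        by (simp add: mult.assoc)
      moreover have "det C \<noteq> 0"
        using \<open>det D * det C = 1\<close> by auto
      ultimately have "det (D' t) * (1 + t * d) = det D"
        by simp
      then have "\<bar>det D\<bar> = \<bar>det (D' t)\<bar> * (1 + t * d)"
        using elim by (metis abs_mult abs_of_pos)
      then have det: "\<bar>det (D' t)\<bar> = 1 / (1 + t * d) * \<bar>det D\<bar>"
        using elim by simp
      have CD'2: "C' t ** transpose (C' t) ** (transpose (D' t) ** D' t) = mat 1"
        by (rule gram_mult_inverse_gram[OF inv[OF elim]])
      have norm: "(norm (D' t *v v))\<^sup>2 = (norm (D *v v))\<^sup>2 + 2 * \<rho> t * L v + (\<rho> t)\<^sup>2 * M v" for v
        unfolding D' norm_diff_scaleR_square ui L_def M_def
        by (simp add: power2_eq_square mult_ac)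
      show ?case
        by (intro conjI allI CD'2 det norm)
    qed
    show "((\<lambda>t. 1 / (1 + t * d)) has_real_derivative - d) (at 0)"
      by (auto intro!: derivative_eq_intros)
    show "(\<rho> has_real_derivative 1) (at 0)"
      unfolding \<rho>_def by (auto intro!: derivative_eq_intros)
    show "continuous_on UNIV L" "continuous_on UNIV M"
      unfolding L_def M_def by (intro continuous_intros)+
    show "K > 0"
      using K1 K2 by (simp add: K_def add_pos_nonneg)
    show "\<bar>L v\<bar> \<le> K * (norm (D *v v))\<^sup>2" for v
      using K1(2)[of v] K2(1) by (simp add: L_def K_def distrib_right add_increasing2)
    show "0 \<le> M v" for v
      by (simp add: M_def)
    show "M v \<le> K * (norm (D *v v))\<^sup>2" for v
    proof -
      have "M v \<le> (norm u)\<^sup>2 * (K2 * (norm (D *v v))\<^sup>2)"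
        unfolding M_def using K2(2)[of v] by (intro mult_left_mono) auto
      then show ?thesis
        using K1(1) by (simp add: K_def distrib_right add_increasing)
    qed
  qed (simp_all add: \<rho>_def)
  then show ?thesis
    by (simp add: L_def C'_def d_def P_def)
qed

text \<open>Here the perturbed matrix is itself a factor of the precision: the vector
  \<open>transpose T *v v\<close> merely gains \<open>t * v $ i\<close> in component
  \<open>j\<close>. The tilt parameter is thus \<open>t\<close>, and the density is multiplied by
  \<open>1 + t * d\<close>.\<close>

lemma integral_mvn_derivative_prec_factor:
  fixes T T' S :: "real^'n^'n" and h :: "real^'n \<Rightarrow> real"
  assumes h: "h \<in> borel_measurable borel" and TT': "T ** T' = mat 1" and S: "S ** (T ** transpose T) = mat 1"
    and a: "a < 1 / 2" and int: "integrable lborel (\<lambda>x. h x * exp (- a * (norm (transpose T *v (x - m)))\<^sup>2))"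
  shows "((\<lambda>t. \<integral>x. h x \<partial>mvn m (matrix_inv ((T + t *\<^sub>R axis i (axis j 1)) ** transpose (T + t *\<^sub>R axis i (axis j 1)))))
    has_real_derivative
      T' $ j $ i * (\<integral>x. h x \<partial>mvn m S) - (\<integral>x. h x * ((x - m) $ i * (transpose T *v (x - m)) $ j) \<partial>mvn m S)) (at 0)"
proof -
  define d where "d = T' $ j $ i"
  define U where "U t = T + t *\<^sub>R axis i (axis j 1)" for t
  define L where "L v = v $ i * (transpose T *v v) $ j" for v
  define M where "M v = v $ i * v $ i" for v :: "real^'n"
  have U: "transpose (U t) *v v = transpose T *v v + (t * v $ i) *\<^sub>R axis j 1" for t v
  proof -
    have "transpose (U t) = transpose T + t *\<^sub>R axis j (axis i 1)"
      by (auto simp: U_def vec_eq_iff transpose_def axis_def)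
    then show ?thesis
      by (simp add: matrix_vector_mult_add_rdistrib matrix_unit_mult_vec scaleR_matrix_vector_assoc[symmetric])
  qed
  have inv: "transpose T' ** transpose T = mat 1"
    by (metis TT' matrix_transpose_mul transpose_mat)
  \<comment> \<open>The identity matrix puts the bare coordinate \<open>v $ i\<close> into the shape
    of a product of two linear images.\<close>
  obtain K1 where K1: "K1 > 0" "\<And>v. \<bar>(mat 1 *v v) $ i * (transpose T *v v) $ j\<bar> \<le> K1 * (norm (transpose T *v v))\<^sup>2"
    using quadratic_form_bound[OF inv] by blast
  obtain K2 where K2: "K2 > 0" "\<And>v. \<bar>(mat 1 *v v) $ i * (mat 1 *v v) $ i\<bar> \<le> K2 * (norm (transpose T *v v))\<^sup>2"
    using quadratic_form_bound[OF inv] by blast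
  define K where "K = K1 + K2"
  have det0: "det T \<noteq> 0"
    using arg_cong[OF TT', of det] by (auto simp: det_mul)
  have "((\<lambda>t. \<integral>x. h x \<partial>mvn m (matrix_inv (U t ** transpose (U t)))) has_real_derivative
      d * (\<integral>x. h x \<partial>mvn m S) - (\<integral>x. h x * L (x - m) \<partial>mvn m S)) (at 0)"
  proof (rule integral_mvn_has_derivative[OF h _ a int, where \<alpha> = "\<lambda>t. 1 + t * d" and \<rho> = "\<lambda>t. t"
        and R' = "\<lambda>t. transpose (U t)" and M = M and K = K])
    show "S ** (transpose (transpose T) ** transpose T) = mat 1"
      using S by simp
    have "\<forall>\<^sub>F t in nhds 0. 1 + t * d > 0"
      by (rule order_tendstoD(1)[where y = 1]) (auto intro!: tendsto_eq_intros filterlim_ident)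
    then show "\<forall>\<^sub>F t in nhds 0. matrix_inv (U t ** transpose (U t)) ** (transpose (transpose (U t)) ** transpose (U t)) = mat 1 \<and>
        \<bar>det (transpose (U t))\<bar> = (1 + t * d) * \<bar>det (transpose T)\<bar> \<and>
        (\<forall>v. (norm (transpose (U t) *v v))\<^sup>2 = (norm (transpose T *v v))\<^sup>2 + 2 * t * L v + t\<^sup>2 * M v)"
    proof eventually_elim
      case (elim t)
      have det: "det (U t) = (1 + t * d) * det T"
        unfolding U_def d_def by (rule det_add_matrix_unit[OF TT'])
      then have "det (U t ** transpose (U t)) \<noteq> 0"
        using elim det0 by (simp add: det_mul)
      then obtain X where "(U t ** transpose (U t)) ** X = mat 1"
        by (auto simp: invertible_det_nz[symmetric] invertible_def)
      then have "matrix_inv (U t ** transpose (U t)) ** (U t ** transpose (U t)) = mat 1"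
        by (metis matrix_inv_eqI matrix_left_right_inverse)
      moreover have "(norm (transpose (U t) *v v))\<^sup>2 = (norm (transpose T *v v))\<^sup>2 + 2 * t * L v + t\<^sup>2 * M v" for v
        unfolding U L_def M_def power2_norm_eq_inner
        by (simp add: inner_add inner_axis inner_axis' power2_eq_square algebra_simps)
      ultimately show ?case
        using det elim by (simp add: abs_mult)
    qed
    show "((\<lambda>t. 1 + t * d) has_real_derivative d) (at 0)"
      by (auto intro!: derivative_eq_intros)
    show "continuous_on UNIV L" "continuous_on UNIV M"
      unfolding L_def M_def by (intro continuous_intros)+
    show "K > 0"
      using K1 K2 by (simp add: K_def)
    show "\<bar>L v\<bar> \<le> K * (norm (transpose T *v v))\<^sup>2" for v
      using K1(2)[of v] K2(1) by (simp add: L_def K_def distrib_right add_increasing2)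
    show "0 \<le> M v" for v
      by (simp add: M_def)
    show "M v \<le> K * (norm (transpose T *v v))\<^sup>2" for v
      using K2(2)[of v] K1(1) by (simp add: M_def K_def distrib_right add_increasing)
  qed simp_all
  then show ?thesis
    by (simp add: L_def U_def d_def)
qed

section \<open>Gaussian expectations of matrices\<close>

lemma linear_imp_bounded_linear:
  fixes f :: "'a::euclidean_space \<Rightarrow> 'b::real_normed_vector"
  assumes "\<And>x y. f (x + y) = f x + f y" "\<And>r x. f (r *\<^sub>R x) = r *\<^sub>R f x"
  shows "bounded_linear f"
  using assms by (simp add: linear_conv_bounded_linear[symmetric] linearI)

lemma bounded_linear_matrix_mult_right: "bounded_linear (\<lambda>A. A ** B)"
  for B :: "real^'n^'m"
  by (rule linear_imp_bounded_linear)
    (simp_all add: vec_eq_iff matrix_matrix_mult_def sum.distrib sum_distrib_left algebra_simps)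

lemma bounded_linear_matrix_mult_left: "bounded_linear (\<lambda>A. B ** A)"
  for B :: "real^'n^'m"
  by (rule linear_imp_bounded_linear)
    (simp_all add: vec_eq_iff matrix_matrix_mult_def sum.distrib sum_distrib_left algebra_simps)

lemma bounded_linear_transpose: "bounded_linear (transpose :: real^'n^'m \<Rightarrow> real^'m^'n)"
  by (rule linear_imp_bounded_linear) (simp_all add: vec_eq_iff transpose_def)

lemmas matrix_diff_rdistrib = linear_diff[OF bounded_linear.linear[OF bounded_linear_matrix_mult_right]]
lemmas matrix_diff_ldistrib = linear_diff[OF bounded_linear.linear[OF bounded_linear_matrix_mult_left]]
lemmas transpose_diff = linear_diff[OF bounded_linear.linear[OF bounded_linear_transpose]]

lemma bounded_linear_entry: "bounded_linear (\<lambda>A :: real^'n^'m. A $ i $ j)"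
  by (rule linear_imp_bounded_linear) simp_all

lemma bounded_linear_vech: "bounded_linear vech"
  by (rule linear_imp_bounded_linear) (simp_all add: vec_eq_iff vech_def)

text \<open>Away from \<open>m\<close> the function is recovered by multiplying once more by the
  coordinates, summing and dividing by the squared norm. This yields measurability of the partial
  derivatives of \<open>h\<close> from that of their products with coordinates.\<close>

lemma borel_measurable_of_coordinate_multiples:
  fixes f :: "real^'n \<Rightarrow> real"
  assumes "\<And>k. (\<lambda>x. f x * (x - m) $ k) \<in> borel_measurable borel"
  shows "f \<in> borel_measurable borel"
proof -
  have "f x = (if x = m then f m else (\<Sum>k\<in>UNIV. f x * (x - m) $ k * (x - m) $ k) / (norm (x - m))\<^sup>2)" for x
  proof -
    have "(\<Sum>k\<in>UNIV. f x * (x - m) $ k * (x - m) $ k) = f x * (norm (x - m))\<^sup>2"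
      by (simp add: power2_norm_eq_inner inner_vec_def sum_distrib_left mult.assoc)
    then show ?thesis
      by simp
  qed
  then have "f = (\<lambda>x. if x = m then f m else (\<Sum>k\<in>UNIV. f x * (x - m) $ k * (x - m) $ k) / (norm (x - m))\<^sup>2)"
    by (rule ext)
  moreover have "\<dots> \<in> borel_measurable borel"
  proof (rule measurable_If)
    have "(\<lambda>x. (x - m) $ k) \<in> borel_measurable borel" for k
      by (intro borel_measurable_continuous_onI continuous_intros)
    moreover have "(\<lambda>x. (norm (x - m))\<^sup>2) \<in> borel_measurable borel"
      by (intro borel_measurable_continuous_onI continuous_intros)
    ultimately show "(\<lambda>x. (\<Sum>k\<in>UNIV. f x * (x - m) $ k * (x - m) $ k) / (norm (x - m))\<^sup>2) \<in> borel_measurable borel"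
      by (intro borel_measurable_divide borel_measurable_sum borel_measurable_times[OF assms])
  qed simp_all
  ultimately show ?thesis
    by simp
qed

text \<open>The matrix \<open>(1 + e) *\<^sub>R C\<close> is lower triangular and close to
  \<open>C\<close> for small \<open>e > 0\<close>, so \<open>h\<close> is integrable against its
  Gaussian. The exponent there has \<open>a = 1 / (2 * (1 + e)\<^sup>2)\<close>, strictly below
  \<open>1 / 2\<close>.\<close>

lemma integrable_dilated_gauss:
  fixes C D :: "'n::{finite,linorder} sqmat"
  assumes ev: "\<forall>\<^sub>F C' in nhds C. lower_triangular C' \<longrightarrow> integrable (mvn m (C' ** transpose C')) h"
    and C: "lower_triangular C" and DC: "D ** C = mat 1"
  obtains a where "a < 1 / 2" "integrable lborel (\<lambda>x. h x * exp (- a * (norm (D *v (x - m)))\<^sup>2))"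
proof -
  have "integrable (mvn m (C ** transpose C)) h"
    using eventually_nhds_x_imp_x[OF ev] C by simp
  then have h: "h \<in> borel_measurable borel"
    by (auto simp: mvn_def dest: borel_measurable_integrable)
  have "((\<lambda>e. (1 + e) *\<^sub>R C) \<longlongrightarrow> C) (at_right 0)"
    by (auto intro!: tendsto_eq_intros)
  then have "\<forall>\<^sub>F e in at_right 0. lower_triangular ((1 + e) *\<^sub>R C) \<longrightarrow>
      integrable (mvn m (((1 + e) *\<^sub>R C) ** transpose ((1 + e) *\<^sub>R C))) h"
    using ev by (rule eventually_compose_filterlim[rotated])
  then have "\<forall>\<^sub>F e in at_right (0::real). 0 < e \<and> (lower_triangular ((1 + e) *\<^sub>R C) \<longrightarrow>
      integrable (mvn m (((1 + e) *\<^sub>R C) ** transpose ((1 + e) *\<^sub>R C))) h)"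
    using eventually_at_right_less[of 0] by eventually_elim blast
  then obtain e :: real where e: "0 < e" and "lower_triangular ((1 + e) *\<^sub>R C) \<longrightarrow>
      integrable (mvn m (((1 + e) *\<^sub>R C) ** transpose ((1 + e) *\<^sub>R C))) h"
    using eventually_happens'[OF trivial_limit_at_right_real] by blast
  then have int: "integrable (mvn m (((1 + e) *\<^sub>R C) ** transpose ((1 + e) *\<^sub>R C))) h"
    using C by (simp add: lower_triangular_def)
  define D' where "D' = (1 / (1 + e)) *\<^sub>R D"
  have "D' ** ((1 + e) *\<^sub>R C) = mat 1"
    using e DC by (simp add: D'_def matrix_scalar_ac scalar_matrix_assoc[symmetric])
  from integrable_mvn_iff[OF gram_mult_inverse_gram[OF this] h] int
  have "integrable lborel (\<lambda>x. h x * gauss_weight D' m x)"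
    by simp
  also have "gauss_weight D' m = (\<lambda>x. exp (- (1 / (2 * (1 + e)\<^sup>2)) * (norm (D *v (x - m)))\<^sup>2))"
    using e by (simp add: fun_eq_iff gauss_weight_def D'_def scaleR_matrix_vector_assoc[symmetric]
        power_mult_distrib power_divide)
  finally have "integrable lborel (\<lambda>x. h x * exp (- (1 / (2 * (1 + e)\<^sup>2)) * (norm (D *v (x - m)))\<^sup>2))" .
  moreover have "1 < (1 + e)\<^sup>2"
    using e by simp
  then have "1 / (2 * (1 + e)\<^sup>2) < 1 / 2"
    by (simp add: divide_simps)
  ultimately show ?thesis
    using that by blast
qed

text \<open>The entrywise Stein identities in matrix form; \<open>O'\<close> is the outer product of
  the gradient of \<open>h\<close> with \<open>x - m\<close>. The wider Gaussian supplies the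
  moments of \<open>h\<close> up to order two, and the integrability of \<open>O'\<close> and of the
  Hessian supplies the rest.\<close>

lemma gaussian_moment_matrices:
  fixes D S :: "real^'n^'n" and h :: "real^'n \<Rightarrow> real" and m :: "real^'n"
  defines "P \<equiv> transpose D ** D"
    and "W \<equiv> \<chi> i j. \<integral>x. h x * ((x - m) $ i * (x - m) $ j) \<partial>mvn m S"
    and "O' \<equiv> \<lambda>x. \<chi> i j. partial_deriv i h x * (x - m) $ j"
  assumes h: "h \<in> borel_measurable borel" and S: "S ** P = mat 1"
    and a: "a < 1 / 2" and int: "integrable lborel (\<lambda>x. h x * exp (- a * (norm (D *v (x - m)))\<^sup>2))"
    and reg: "locally_abs_continuous h" "ae_partials_exist h"
      "\<And>i. locally_abs_continuous (partial_deriv i h)" "\<And>i. ae_partials_exist (partial_deriv i h)"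
    and intO: "integrable (mvn m S) O'" and intH: "integrable (mvn m S) (hessian h)"
  shows "(\<integral>x. h x * ((A *v (x - m)) $ i * (B *v (x - m)) $ j) \<partial>mvn m S) = (A ** W ** transpose B) $ i $ j"
      (is ?moment)
    and "(\<integral>x. O' x \<partial>mvn m S) = P ** W - (\<integral>x. h x \<partial>mvn m S) *\<^sub>R mat 1" (is ?first)
    and "(\<integral>x. hessian h x \<partial>mvn m S) = P ** transpose (\<integral>x. O' x \<partial>mvn m S)" (is ?second)
proof -
  note S' = S[unfolded P_def]
  have [measurable]: "h \<in> borel_measurable borel"
    by (rule h)
  define q where "q = gauss_weight D m"
  define c where "c = \<bar>det D\<bar> / sqrt ((2 * pi) ^ CARD('n))"
  have E: "(\<integral>x. f x \<partial>mvn m S) = c * (\<integral>x. f x * q x \<partial>lborel)"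
    and I: "integrable (mvn m S) f \<longleftrightarrow> integrable lborel (\<lambda>x. f x * q x)"
    if "f \<in> borel_measurable borel" for f
    using integral_mvn[OF S' that, of m] integrable_mvn_iff[OF S' that, of m]
    by (simp_all add: c_def q_def)
  have mvn_meas: "f \<in> borel_measurable borel" if "integrable (mvn m S) f" for f :: "real^'n \<Rightarrow> real"
    using borel_measurable_integrable[OF that] by (simp add: mvn_def)

  have DD: "(S ** transpose D) ** D = mat 1"
    using S' by (simp add: matrix_mul_assoc)
  define Q where "Q x = (norm (D *v (x - m)))\<^sup>2" for x
  have Q: "Q \<in> borel_measurable borel" "\<And>x. Q x \<ge> 0" "q = (\<lambda>x. exp (- Q x / 2))"
    unfolding Q_def q_def gauss_weight_def[abs_def]
    by (intro borel_measurable_continuous_onI continuous_intros) simp_all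
  have coord: "(\<lambda>x. (x - m) $ i) \<in> borel_measurable borel" for i
    by (intro borel_measurable_continuous_onI continuous_intros)
  have intp: "integrable lborel (\<lambda>x. h x * p x * q x)"
    if "p \<in> borel_measurable borel" "\<And>x. \<bar>p x\<bar> \<le> K * (1 + Q x)" for p K
    unfolding Q(3) by (rule integrable_mult_gauss[OF h that(1) Q(1) a _ Q(2) that(2)]) (use int in \<open>simp add: Q_def\<close>)
  have int0: "integrable lborel (\<lambda>x. h x * q x)"
    using intp[of "\<lambda>_. 1" 1] Q(2) by simp
  have int2: "integrable lborel (\<lambda>x. h x * ((x - m) $ i * (x - m) $ j) * q x)" for i j
  proof -
    obtain K where K: "K > 0" "\<And>v. \<bar>(mat 1 *v v) $ i * (mat 1 *v v) $ j\<bar> \<le> K * (norm (D *v v))\<^sup>2"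
      using quadratic_form_bound[OF DD] by blast
    then have "\<bar>(x - m) $ i * (x - m) $ j\<bar> \<le> K * (1 + Q x)" for x
      using K(2)[of "x - m"] by (simp add: Q_def distrib_left add_increasing)
    then show ?thesis
      using coord by (intro intp) auto
  qed
  have int1: "integrable lborel (\<lambda>x. h x * (x - m) $ i * q x)" for i
  proof -
    obtain K where K: "K > 0" "\<And>v. \<bar>(mat 1 *v v) $ i * (mat 1 *v v) $ i\<bar> \<le> K * (norm (D *v v))\<^sup>2"
      using quadratic_form_bound[OF DD] by blast
    have "\<bar>(x - m) $ i\<bar> \<le> (1 + K) * (1 + Q x)" for x
    proof -
      \<comment> \<open>Brings a factor of degree one under the available quadratic bound.\<close>
      have "\<bar>y\<bar> \<le> 1 + y * y" for y :: real
        using zero_le_power2[of "\<bar>y\<bar> - 1 / 2"] by (simp add: power2_eq_square algebra_simps)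
      moreover have "\<bar>(x - m) $ i * (x - m) $ i\<bar> \<le> K * Q x"
        using K(2)[of "x - m"] by (simp add: Q_def)
      ultimately have "\<bar>(x - m) $ i\<bar> \<le> 1 + K * Q x"
        by (smt (verit))
      also have "\<dots> \<le> (1 + K) * (1 + Q x)"
        using K(1) Q(2)[of x] by (simp add: algebra_simps)
      finally show ?thesis .
    qed
    then show ?thesis
      using coord by (intro intp) auto
  qed

  have W: "W $ i $ j = c * (\<integral>x. h x * ((x - m) $ i * (x - m) $ j) * q x \<partial>lborel)" for i j
    using coord by (simp add: W_def E)
  have "h x * ((A *v (x - m)) $ i * (B *v (x - m)) $ j) =
      (\<Sum>k\<in>UNIV. \<Sum>l\<in>UNIV. A $ i $ k * B $ j $ l * (h x * ((x - m) $ k * (x - m) $ l)))" for x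
    unfolding matrix_vector_mult_def vec_lambda_beta sum_product by (simp add: sum_distrib_left mult_ac)
  moreover have "integrable (mvn m S) (\<lambda>x. h x * ((x - m) $ k * (x - m) $ l))" for k l
    by (subst I) (use int2 coord in auto)
  ultimately have "(\<integral>x. h x * ((A *v (x - m)) $ i * (B *v (x - m)) $ j) \<partial>mvn m S) =
      (\<Sum>k\<in>UNIV. \<Sum>l\<in>UNIV. A $ i $ k * B $ j $ l * W $ k $ l)"
    by (simp add: W_def)
  also have "\<dots> = (A ** W ** transpose B) $ i $ j"
    by (subst sum.swap) (simp add: matrix_matrix_mult_def transpose_def sum_distrib_right sum_distrib_left mult_ac)
  finally show ?moment .

  have O_entry: "integrable (mvn m S) (\<lambda>x. partial_deriv l h x * (x - m) $ i)"
    "(\<integral>x. O' x \<partial>mvn m S) $ l $ i = (\<integral>x. partial_deriv l h x * (x - m) $ i \<partial>mvn m S)" for l i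
    using integrable_bounded_linear[OF bounded_linear_entry intO, of l i]
      integral_bounded_linear[OF bounded_linear_entry intO, of l i]
    by (simp_all add: O'_def)
  have hess: "hessian h x $ k $ l = partial_deriv k (partial_deriv l h) x" for x k l
    by (simp add: hessian_def)
  have H_entry: "integrable (mvn m S) (partial_deriv k (partial_deriv l h))"
    "(\<integral>x. hessian h x \<partial>mvn m S) $ k $ l = (\<integral>x. partial_deriv k (partial_deriv l h) x \<partial>mvn m S)" for k l
    using integrable_bounded_linear[OF bounded_linear_entry intH, of k l]
      integral_bounded_linear[OF bounded_linear_entry intH, of k l]
    by (simp_all add: hess)
  have O_int: "integrable lborel (\<lambda>x. partial_deriv l h x * (x - m) $ i * q x)" for l i
    using O_entry(1) I[OF mvn_meas[OF O_entry(1)]] by blast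
  have H_int: "integrable lborel (\<lambda>x. partial_deriv k (partial_deriv l h) x * q x)" for k l
    using H_entry(1) I[OF mvn_meas[OF H_entry(1)]] by blast
  have pd_meas: "partial_deriv l h \<in> borel_measurable borel" for l
    by (rule borel_measurable_of_coordinate_multiples[OF mvn_meas[OF O_entry(1)]])

  have U: "(\<integral>x. O' x \<partial>mvn m S) $ l $ i = c * (\<integral>x. partial_deriv l h x * (x - m) $ i * q x \<partial>lborel)" for l i
    unfolding O_entry(2) by (rule E[OF mvn_meas[OF O_entry(1)]])
  \<comment> \<open>Stein's identity sums \<open>P $ l $ j * W $ i $ j\<close> over
    \<open>j\<close>; symmetry turns this into an entry of \<open>P ** W\<close>.\<close>
  have W_sym: "W $ i $ j = W $ j $ i" for i j
    by (simp add: W_def mult.commute)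
  have "(\<integral>x. O' x \<partial>mvn m S) $ l $ i = (P ** W - (\<integral>x. h x \<partial>mvn m S) *\<^sub>R mat 1) $ l $ i" for l i
  proof -
    have "(\<integral>x. O' x \<partial>mvn m S) $ l $ i = c * ((\<Sum>j\<in>UNIV. P $ l $ j * (\<integral>x. h x * ((x - m) $ i * (x - m) $ j) * q x \<partial>lborel))
        - (if i = l then \<integral>x. h x * q x \<partial>lborel else 0))"
      unfolding U P_def q_def
      by (subst stein_first_order) (use reg int0 int1 int2 O_int in \<open>auto simp: q_def\<close>)
    also have "\<dots> = (\<Sum>j\<in>UNIV. P $ l $ j * W $ i $ j) - (if i = l then \<integral>x. h x \<partial>mvn m S else 0)"
      by (simp add: W E[OF h] right_diff_distrib sum_distrib_left mult_ac)
    also have "\<dots> = (P ** W - (\<integral>x. h x \<partial>mvn m S) *\<^sub>R mat 1) $ l $ i"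
      by (simp add: matrix_matrix_mult_def mat_def W_sym[of i])
    finally show ?thesis .
  qed
  then show ?first
    by (simp add: vec_eq_iff)

  \<comment> \<open>The column index \<open>l\<close> belongs to the inner derivative, so the
    identity is applied to \<open>partial_deriv l h\<close>; this is why the transpose of the
    expected \<open>O'\<close> appears.\<close>
  have "(\<integral>x. hessian h x \<partial>mvn m S) $ k $ l = (P ** transpose (\<integral>x. O' x \<partial>mvn m S)) $ k $ l" for k l
  proof -
    have "(\<integral>x. hessian h x \<partial>mvn m S) $ k $ l = c * (\<integral>x. partial_deriv k (partial_deriv l h) x * q x \<partial>lborel)"
      unfolding H_entry(2) by (rule E[OF mvn_meas[OF H_entry(1)]])
    also have "\<dots> = c * (\<Sum>i\<in>UNIV. P $ k $ i * (\<integral>x. partial_deriv l h x * (x - m) $ i * q x \<partial>lborel))"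
      unfolding P_def q_def
      by (subst stein_zeroth_order) (use reg pd_meas O_int H_int in \<open>auto simp: q_def\<close>)
    also have "\<dots> = (P ** transpose (\<integral>x. O' x \<partial>mvn m S)) $ k $ l"
      by (simp add: matrix_matrix_mult_def transpose_def U sum_distrib_left mult_ac)
    finally show ?thesis .
  qed
  then show ?second
    by (simp add: vec_eq_iff)
qed

theorem theorem1:
  fixes \<mu> :: "'n::{finite,linorder} rvec"
    and \<Sigma> C T :: "'n sqmat"
    and lik :: "'y \<Rightarrow> 'n rvec \<Rightarrow> real" and prior :: "'n rvec \<Rightarrow> real" and y :: 'y
    and h :: "'n rvec \<Rightarrow> real"
    and G\<^sub>1 F\<^sub>1 G\<^sub>2 F\<^sub>2 :: "'n rvec \<Rightarrow> 'n sqmat"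
  assumes "sym_pos_def \<Sigma>"
    and "cholesky_decomp \<Sigma> C"
    and "cholesky_decomp (matrix_inv \<Sigma>) T"
    and "\<And>\<theta>. lik y \<theta> * prior \<theta> > 0"
    and "\<And>\<theta>. h \<theta> = ln (lik y \<theta> * prior \<theta>) - ln (mvn_density \<mu> \<Sigma> \<theta>)"
    \<comment> \<open>regularity: \<open>h\<close> and the components of its gradient\<close>
    and "locally_abs_continuous h" and "ae_partials_exist h"
    and "\<And>i. locally_abs_continuous (partial_deriv i h)"
    and "\<And>i. ae_partials_exist (partial_deriv i h)"
    \<comment> \<open>the maps to be differentiated are defined near \<open>C\<close> and near \<open>T\<close>\<close>
    and "\<forall>\<^sub>F C' in nhds C. lower_triangular C' \<longrightarrow> integrable (mvn \<mu> (C' ** transpose C')) h"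
    and "\<forall>\<^sub>F T' in nhds T. lower_triangular T' \<longrightarrow>
           integrable (mvn \<mu> (matrix_inv (T' ** transpose T'))) h"
    and "\<And>\<theta>. G\<^sub>1 \<theta> = columnvector (grad h \<theta>) ** (rowvector (\<theta> - \<mu>) :: ('n rvec)^1)
                     ** transpose (matrix_inv C)"
    and "\<And>\<theta>. F\<^sub>1 \<theta> = hessian h \<theta> ** C"
    and "\<And>\<theta>. G\<^sub>2 \<theta> = - (columnvector (\<theta> - \<mu>) ** (rowvector (grad h \<theta>) :: ('n rvec)^1)
                     ** transpose (matrix_inv T))"
    and "\<And>\<theta>. F\<^sub>2 \<theta> = - (\<Sigma> ** hessian h \<theta> ** transpose (matrix_inv T))"
    \<comment> \<open>the expectations exist\<close>
    and "integrable (mvn \<mu> \<Sigma>) G\<^sub>1" and "integrable (mvn \<mu> \<Sigma>) F\<^sub>1"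
    and "integrable (mvn \<mu> \<Sigma>) G\<^sub>2" and "integrable (mvn \<mu> \<Sigma>) F\<^sub>2"
  shows "((\<integral>\<theta>. G\<^sub>1 \<theta> \<partial>mvn \<mu> \<Sigma>) = (\<integral>\<theta>. F\<^sub>1 \<theta> \<partial>mvn \<mu> \<Sigma>) \<and>
          has_vech_gradient (\<lambda>C'. \<integral>\<theta>. h \<theta> \<partial>mvn \<mu> (C' ** transpose C'))
            (\<integral>\<theta>. vech (G\<^sub>1 \<theta>) \<partial>mvn \<mu> \<Sigma>) C \<and>
          (\<integral>\<theta>. vech (G\<^sub>1 \<theta>) \<partial>mvn \<mu> \<Sigma>) = (\<integral>\<theta>. vech (F\<^sub>1 \<theta>) \<partial>mvn \<mu> \<Sigma>))
       \<and> ((\<integral>\<theta>. G\<^sub>2 \<theta> \<partial>mvn \<mu> \<Sigma>) = (\<integral>\<theta>. F\<^sub>2 \<theta> \<partial>mvn \<mu> \<Sigma>) \<and>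
          has_vech_gradient (\<lambda>T'. \<integral>\<theta>. h \<theta> \<partial>mvn \<mu> (matrix_inv (T' ** transpose T')))
            (\<integral>\<theta>. vech (G\<^sub>2 \<theta>) \<partial>mvn \<mu> \<Sigma>) T \<and>
          (\<integral>\<theta>. vech (G\<^sub>2 \<theta>) \<partial>mvn \<mu> \<Sigma>) = (\<integral>\<theta>. vech (F\<^sub>2 \<theta>) \<partial>mvn \<mu> \<Sigma>))"
proof -
  note spd = assms(1) and regular = assms(6-9) and G\<^sub>1 = assms(12) and F\<^sub>1 = assms(13) and G\<^sub>2 = assms(14) and F\<^sub>2 = assms(15)
    and intG\<^sub>1 = assms(16) and intF\<^sub>1 = assms(17) and intG\<^sub>2 = assms(18) and intF\<^sub>2 = assms(19)
  have lower: "lower_triangular C" and CC: "C ** transpose C = \<Sigma>" and TT: "T ** transpose T = matrix_inv \<Sigma>"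
    using assms(2,3) by (simp_all add: cholesky_decomp_def)
  define D where "D = matrix_inv C"
  define T' where "T' = matrix_inv T"
  define P where "P = transpose D ** D"

  \<comment> \<open>Invertibility of the covariance and of its Cholesky factors\<close>
  have "x = 0" if "\<Sigma> *v x = 0" for x
    using spd that unfolding sym_pos_def_def by (metis inner_zero_right less_irrefl)
  then obtain X where "X ** \<Sigma> = mat 1"
    using matrix_left_invertible_ker[of \<Sigma>] by blast
  \<comment> \<open>A right inverse of \<open>C\<close> comes from regrouping the product of
    \<open>\<Sigma>\<close> with its inverse.\<close>
  then have "C ** (transpose C ** X) = mat 1"
    by (simp add: matrix_mul_assoc CC matrix_left_right_inverse)
  then have CD: "C ** D = mat 1"
    using matrix_inv_eqI unfolding D_def by metis
  then have DC: "D ** C = mat 1"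
    by (simp add: matrix_left_right_inverse)
  have SP: "\<Sigma> ** P = mat 1"
    using gram_mult_inverse_gram[OF DC] by (simp add: CC P_def)
  then have PS: "P ** \<Sigma> = mat 1"
    by (simp add: matrix_left_right_inverse)
  have TTP: "T ** transpose T = P"
    unfolding TT by (rule matrix_inv_eqI[OF SP])
  have "T ** (transpose T ** \<Sigma>) = mat 1"
    by (simp add: matrix_mul_assoc TTP PS)
  then have TT': "T ** T' = mat 1"
    using matrix_inv_eqI unfolding T'_def by metis
  then have T'T: "T' ** T = mat 1"
    by (simp add: matrix_left_right_inverse)
  have P_sym: "transpose P = P"
    by (simp add: P_def matrix_transpose_mul)

  \<comment> \<open>Integrability of \<open>h\<close>, of the gradient products and of the
    Hessian\<close>
  have "integrable (mvn \<mu> \<Sigma>) h"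
    using eventually_nhds_x_imp_x[OF assms(10)] lower by (simp add: CC)
  then have h: "h \<in> borel_measurable borel"
    by (auto simp: mvn_def dest: borel_measurable_integrable)
  obtain a where a: "a < 1 / 2"
    and int: "integrable lborel (\<lambda>x. h x * exp (- a * (norm (D *v (x - \<mu>)))\<^sup>2))"
    using integrable_dilated_gauss[OF assms(10) lower DC] .

  define O' where "O' \<theta> = (\<chi> i j. partial_deriv i h \<theta> * (\<theta> - \<mu>) $ j)" for \<theta>
  have O': "columnvector (grad h \<theta>) ** (rowvector (\<theta> - \<mu>) :: ('n rvec)^1) = O' \<theta>"
    "columnvector (\<theta> - \<mu>) ** (rowvector (grad h \<theta>) :: ('n rvec)^1) = transpose (O' \<theta>)" for \<theta>
    by (simp_all add: O'_def vec_eq_iff matrix_matrix_mult_def columnvector_def rowvector_def grad_def transpose_def)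
  \<comment> \<open>Cancelling the constant matrix factors in \<open>G\<^sub>1\<close> and
    \<open>F\<^sub>1\<close> transfers their integrability to \<open>O'\<close> and to the
    Hessian.\<close>
  have O_eq: "O' \<theta> = G\<^sub>1 \<theta> ** transpose C" for \<theta>
    unfolding G\<^sub>1 O' D_def[symmetric]
    by (simp add: matrix_mul_assoc[symmetric] matrix_transpose_mul[symmetric] CD transpose_mat)
  have H_eq: "hessian h \<theta> = F\<^sub>1 \<theta> ** D" for \<theta>
    unfolding F\<^sub>1 by (simp add: matrix_mul_assoc[symmetric] CD)
  have intO: "integrable (mvn \<mu> \<Sigma>) O'"
    unfolding O_eq[abs_def] by (rule integrable_bounded_linear[OF bounded_linear_matrix_mult_right intG\<^sub>1])
  have intH: "integrable (mvn \<mu> \<Sigma>) (hessian h)"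
    unfolding H_eq[abs_def] by (rule integrable_bounded_linear[OF bounded_linear_matrix_mult_right intF\<^sub>1])

  \<comment> \<open>Relations between the moment matrices\<close>
  define W :: "'n sqmat" where "W = (\<chi> i j. \<integral>\<theta>. h \<theta> * ((\<theta> - \<mu>) $ i * (\<theta> - \<mu>) $ j) \<partial>mvn \<mu> \<Sigma>)"
  define U where "U = (\<integral>\<theta>. O' \<theta> \<partial>mvn \<mu> \<Sigma>)"
  define V where "V = (\<integral>\<theta>. hessian h \<theta> \<partial>mvn \<mu> \<Sigma>)"
  define e where "e = (\<integral>\<theta>. h \<theta> \<partial>mvn \<mu> \<Sigma>)"
  note moments = gaussian_moment_matrices[OF h SP[unfolded P_def] a int regular intO[unfolded O'_def[abs_def]] intH,
      folded W_def P_def O'_def[abs_def]]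
  have moment: "(\<integral>\<theta>. h \<theta> * ((A *v (\<theta> - \<mu>)) $ i * (B *v (\<theta> - \<mu>)) $ j) \<partial>mvn \<mu> \<Sigma>) = (A ** W ** transpose B) $ i $ j" for A B i j
    by (rule moments(1))
  have U: "U = P ** W - e *\<^sub>R mat 1"
    unfolding U_def e_def by (rule moments(2))
  have V: "V = P ** transpose U"
    unfolding U_def V_def by (rule moments(3))
  have W_sym: "transpose W = W"
    by (simp add: W_def vec_eq_iff transpose_def mult.commute)
  have U': "transpose U = W ** P - e *\<^sub>R mat 1"
    using arg_cong[OF U, of transpose] P_sym W_sym
    by (simp add: transpose_diff matrix_transpose_mul transpose_scalar transpose_mat)
  \<comment> \<open>Both \<open>P ** transpose U\<close> and \<open>U ** P\<close> equal
    \<open>P ** W ** P - e *\<^sub>R P\<close>; this is the symmetry of the expected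
    Hessian.\<close>
  have V': "V = U ** P"
    unfolding V U' unfolding U by (simp add: matrix_mul_assoc matrix_diff_ldistrib matrix_diff_rdistrib matrix_scalar_ac scalar_matrix_assoc[symmetric])

  \<comment> \<open>Equality of the two expectations in each part\<close>
  have EG\<^sub>1: "(\<integral>\<theta>. G\<^sub>1 \<theta> \<partial>mvn \<mu> \<Sigma>) = U ** transpose D"
    unfolding G\<^sub>1 O' D_def[symmetric] U_def
    by (rule integral_bounded_linear[OF bounded_linear_matrix_mult_right intO])
  have EF\<^sub>1: "(\<integral>\<theta>. F\<^sub>1 \<theta> \<partial>mvn \<mu> \<Sigma>) = V ** C"
    unfolding F\<^sub>1 V_def
    by (rule integral_bounded_linear[OF bounded_linear_matrix_mult_right intH])
  \<comment> \<open>From \<open>V = U ** transpose D ** D\<close> the factor \<open>D\<close>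
    cancels against \<open>C\<close>.\<close>
  have 1: "(\<integral>\<theta>. G\<^sub>1 \<theta> \<partial>mvn \<mu> \<Sigma>) = (\<integral>\<theta>. F\<^sub>1 \<theta> \<partial>mvn \<mu> \<Sigma>)"
    unfolding EG\<^sub>1 EF\<^sub>1 V' P_def by (simp add: matrix_mul_assoc[symmetric] DC)

  have EG\<^sub>2: "(\<integral>\<theta>. G\<^sub>2 \<theta> \<partial>mvn \<mu> \<Sigma>) = - (transpose U ** transpose T')"
    unfolding G\<^sub>2 O' T'_def[symmetric] U_def
    by (rule integral_bounded_linear[OF bounded_linear_compose[OF bounded_linear_minus[OF bounded_linear_matrix_mult_right] bounded_linear_transpose] intO])
  have EF\<^sub>2: "(\<integral>\<theta>. F\<^sub>2 \<theta> \<partial>mvn \<mu> \<Sigma>) = - (\<Sigma> ** V ** transpose T')"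
    unfolding F\<^sub>2 T'_def[symmetric] V_def
    by (rule integral_bounded_linear[OF bounded_linear_compose[OF bounded_linear_minus[OF bounded_linear_matrix_mult_right] bounded_linear_matrix_mult_left] intH])
  \<comment> \<open>From \<open>V = P ** transpose U\<close> the factor \<open>P\<close> cancels
    against \<open>\<Sigma>\<close>.\<close>
  have 2: "(\<integral>\<theta>. G\<^sub>2 \<theta> \<partial>mvn \<mu> \<Sigma>) = (\<integral>\<theta>. F\<^sub>2 \<theta> \<partial>mvn \<mu> \<Sigma>)"
    unfolding EG\<^sub>2 EF\<^sub>2 V by (simp add: matrix_mul_assoc SP)

  have E_vech: "(\<integral>\<theta>. vech (G \<theta>) \<partial>mvn \<mu> \<Sigma>) = vech (\<integral>\<theta>. G \<theta> \<partial>mvn \<mu> \<Sigma>)"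
    if "integrable (mvn \<mu> \<Sigma>) G" for G :: "'n rvec \<Rightarrow> 'n sqmat"
    by (rule integral_bounded_linear[OF bounded_linear_vech that])

  \<comment> \<open>Gradients with respect to the two Cholesky factors\<close>
  have grad\<^sub>1: "has_vech_gradient (\<lambda>C'. \<integral>\<theta>. h \<theta> \<partial>mvn \<mu> (C' ** transpose C')) (vech (U ** transpose D)) C"
    unfolding has_vech_gradient_def
  proof
    fix p :: "'n ltri"
    let ?i = "row_of p" and ?j = "col_of p"
    \<comment> \<open>The derivative formula carries the indices in the order \<open>?j\<close>,
      \<open>?i\<close>, so the entry is read from the transposed matrix
      \<open>D ** transpose U\<close>.\<close>
    have "(U ** transpose D) $ ?i $ ?j = transpose (D ** transpose U) $ ?i $ ?j"
      by (simp only: matrix_transpose_mul transpose_transpose)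
    also have "\<dots> = (D ** transpose U) $ ?j $ ?i"
      unfolding transpose_def[of "D ** transpose U"] by simp
    also have "D ** transpose U = D ** W ** transpose P - e *\<^sub>R D"
      unfolding U' P_sym by (simp add: matrix_diff_ldistrib matrix_scalar_ac matrix_mul_assoc)
    finally have "(U ** transpose D) $ ?i $ ?j = - D $ ?j $ ?i * e + (D ** W ** transpose P) $ ?j $ ?i"
      by simp
    then show "((\<lambda>t. \<integral>\<theta>. h \<theta> \<partial>mvn \<mu> ((C + t *\<^sub>R axis ?i (axis ?j 1)) ** transpose (C + t *\<^sub>R axis ?i (axis ?j 1))))
        has_real_derivative vech (U ** transpose D) $ p) (at 0)"
      using integral_mvn_derivative_cov_factor[OF h CD a int, of ?i ?j]
      by (simp add: CC P_def[symmetric] moment e_def vech_def)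
  qed

  \<comment> \<open>Both \<open>D\<close> and \<open>transpose T\<close> have Gram matrix
    \<open>P\<close>, so the integrability obtained through \<open>C\<close> also serves the
    derivative in \<open>T\<close>.\<close>
  have norm_eq: "norm (transpose T *v v) = norm (D *v v)" for v
    using inner_transpose_mult[of v "transpose T" v] inner_transpose_mult[of v D v]
    by (simp add: TTP P_def norm_eq)
  have int': "integrable lborel (\<lambda>x. h x * exp (- a * (norm (transpose T *v (x - \<mu>)))\<^sup>2))"
    unfolding norm_eq by (rule int)
  have grad\<^sub>2: "has_vech_gradient (\<lambda>T'. \<integral>\<theta>. h \<theta> \<partial>mvn \<mu> (matrix_inv (T' ** transpose T')))
      (vech (- (transpose U ** transpose T'))) T"
    unfolding has_vech_gradient_def
  proof
    fix p :: "'n ltri"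
    let ?i = "row_of p" and ?j = "col_of p"
    \<comment> \<open>This reduces \<open>transpose U ** transpose T'\<close> to
      \<open>W ** T - e *\<^sub>R transpose T'\<close>, whose two terms match those of the
      derivative up to sign.\<close>
    have "P ** transpose T' = T"
      unfolding TTP[symmetric]
      by (simp add: matrix_mul_assoc[symmetric] matrix_transpose_mul[symmetric] T'T transpose_mat)
    then have "transpose U ** transpose T' = mat 1 ** W ** transpose (transpose T) - e *\<^sub>R transpose T'"
      unfolding U' by (simp add: matrix_diff_rdistrib scalar_matrix_assoc[symmetric] matrix_mul_assoc[symmetric])
    then have "(- (transpose U ** transpose T')) $ ?i $ ?j = T' $ ?j $ ?i * e - (mat 1 ** W ** transpose (transpose T)) $ ?i $ ?j"
      by (simp add: transpose_def)
    then show "((\<lambda>t. \<integral>\<theta>. h \<theta> \<partial>mvn \<mu> (matrix_inv ((T + t *\<^sub>R axis ?i (axis ?j 1)) ** transpose (T + t *\<^sub>R axis ?i (axis ?j 1)))))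
        has_real_derivative vech (- (transpose U ** transpose T')) $ p) (at 0)"
      using integral_mvn_derivative_prec_factor[OF h TT' SP[folded TTP] a int', of ?i ?j]
        moment[of "mat 1" ?i "transpose T" ?j]
      by (simp add: e_def vech_def)
  qed

  show ?thesis
    using 1 2 grad\<^sub>1 grad\<^sub>2 E_vech intG\<^sub>1 intF\<^sub>1 intG\<^sub>2 intF\<^sub>2 EG\<^sub>1 EG\<^sub>2 by simp
qed

end
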